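(* Let $T$ be a tree of order $n$ and diameter $\delta$. Then $$n+\frac{\delta^2}{3}-\delta-1\;\leq\;\kappa(T)\;\leq\; n\delta-\frac{\delta^2}{2}.$$
   Context: All graphs are finite, simple and undirected. The order of a graph is its number of vertices. For a connected graph $G$ on vertices $1,\dots,n$ with $n\ge 2$, adjacency matrix $A$ and diagonal degree matrix $D$, consider the random walk on $G$ with transition matrix $D^{-1}A$. Let $\mathbf{w}=(w_j)$ be its unique stationary distribution ($\mathbf{w}^TD^{-1}A=\mathbf{w}^T$, positive entries summing to $1$), and let $m_{ij}$ be the expected value of the smallest $s\geq 1$ such that the walk started at $i$ is at $j$ at time $s$ (so $m_{ii}$ is the mean return time). Kemeny's constant of $G$ is $\kappa(G)=\sum_{j=1}^n m_{ij}w_j-1$, which does not depend on $i$. By convention, Kemeny's constant of the one-vertex tree is $0$. *)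

theory Defs
  imports "HOL-Probability.Probability" "Graph_Theory.Graph_Theory"
begin

text \<open>
  A finite simple undirected graph is a \<^locale>\<open>pair_graph\<close>: a finite, loop-free, symmetric digraph
  whose arcs are ordered pairs of vertices. An undirected edge is a pair of opposite arcs, so the
  degree of a vertex is its out-degree.
\<close>

subsection \<open>Trees and diameter\<close>

text \<open>
  The constant \<^const>\<open>tree\<close> of the library cannot be used for symmetric digraphs, because
  there the two arcs of a single edge already form a cycle, of length 2. The cycles of the
  underlying undirected graph are the cycles of length at least 3.
\<close>

definition is_tree :: "'a pair_pre_digraph \<Rightarrow> bool" where
  "is_tree G \<longleftrightarrow> pair_graph G \<and> connected (with_proj G) \<and>
     \<not> (\<exists>p. pre_digraph.cycle (with_proj G) p \<and> 3 \<le> length p)"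

definition graph_dist :: "'a pair_pre_digraph \<Rightarrow> 'a \<Rightarrow> 'a \<Rightarrow> ereal" where
  "graph_dist G u v = wf_digraph.\<mu> (with_proj G) (\<lambda>_. 1) u v"

definition graph_diameter :: "'a pair_pre_digraph \<Rightarrow> ereal" where
  "graph_diameter G = (SUP u\<in>pverts G. SUP v\<in>pverts G. graph_dist G u v)"

subsection \<open>The random walk\<close>

definition adjacency :: "'a pair_pre_digraph \<Rightarrow> 'a \<Rightarrow> 'a \<Rightarrow> real" where
  "adjacency G i j = (if (i, j) \<in> parcs G then 1 else 0)"

definition vertex_degree :: "'a pair_pre_digraph \<Rightarrow> 'a \<Rightarrow> nat" where
  "vertex_degree G i = out_degree (with_proj G) i"

definition transition :: "'a pair_pre_digraph \<Rightarrow> 'a \<Rightarrow> 'a \<Rightarrow> real" where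
  "transition G i j = adjacency G i j / real (vertex_degree G i)"

text \<open>
  The walk is realised on the space of i.i.d. sequences of random maps: at each time, every vertex
  \<open>v\<close> independently draws a successor from row \<open>v\<close> of the transition matrix, and the walk moves to
  the successor drawn by its current position. By the lemma \<open>random_walk_law\<close> below, this is the
  Markov chain with the given transition matrix whenever all degrees are positive, as is the case
  in a connected graph with at least two vertices.
\<close>

definition random_map :: "'a pair_pre_digraph \<Rightarrow> ('a \<Rightarrow> 'a) measure" where
  "random_map G = (\<Pi>\<^sub>M v\<in>pverts G. point_measure (pverts G) (\<lambda>j. ennreal (transition G v j)))"

definition walk_space :: "'a pair_pre_digraph \<Rightarrow> ('a \<Rightarrow> 'a) stream measure" where
  "walk_space G = stream_space (random_map G)"

primrec walk :: "'a \<Rightarrow> ('a \<Rightarrow> 'a) stream \<Rightarrow> nat \<Rightarrow> 'a" where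
  "walk i \<omega> 0 = i"
| "walk i \<omega> (Suc t) = (\<omega> !! t) (walk i \<omega> t)"

text \<open>The infimum is \<open>\<infinity>\<close> if the walk never visits \<open>j\<close> at a positive time.\<close>

definition hitting_time :: "'a \<Rightarrow> 'a \<Rightarrow> ('a \<Rightarrow> 'a) stream \<Rightarrow> ennreal" where
  "hitting_time i j \<omega> = (INF s \<in> {s. 1 \<le> s \<and> walk i \<omega> s = j}. of_nat s)"

definition mean_hitting_time :: "'a pair_pre_digraph \<Rightarrow> 'a \<Rightarrow> 'a \<Rightarrow> real" where
  "mean_hitting_time G i j = enn2real (\<integral>\<^sup>+ \<omega>. hitting_time i j \<omega> \<partial>walk_space G)"

subsection \<open>Kemeny's constant\<close>

text \<open>The values outside the vertex set are fixed to 0, so that the distribution is unique.\<close>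

definition is_stationary :: "'a pair_pre_digraph \<Rightarrow> ('a \<Rightarrow> real) \<Rightarrow> bool" where
  "is_stationary G w \<longleftrightarrow>
     (\<forall>j\<in>pverts G. (\<Sum>i\<in>pverts G. w i * transition G i j) = w j) \<and>
     (\<forall>j\<in>pverts G. 0 < w j) \<and> (\<Sum>j\<in>pverts G. w j) = 1 \<and>
     (\<forall>j. j \<notin> pverts G \<longrightarrow> w j = 0)"

definition stationary :: "'a pair_pre_digraph \<Rightarrow> 'a \<Rightarrow> real" where
  "stationary G = (THE w. is_stationary G w)"

text \<open>The definite description over \<open>\<kappa>\<close> expresses that the sum does not depend on the start \<open>i\<close>.\<close>

definition kemeny :: "'a pair_pre_digraph \<Rightarrow> real" where
  "kemeny G =
     (if card (pverts G) = 1 then 0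
      else (THE \<kappa>. \<forall>i\<in>pverts G.
              \<kappa> = (\<Sum>j\<in>pverts G. mean_hitting_time G i j * stationary G j) - 1))"

subsection \<open>The law of the walk\<close>

lemma sum_transition:
  assumes "pair_graph G" "vertex_degree G v > 0"
  shows "(\<Sum>j\<in>pverts G. transition G v j) = 1"
proof -
  interpret pair_graph G by fact
  let ?N = "{j \<in> pverts G. (v, j) \<in> parcs G}"
  have oa: "out_arcs (with_proj G) v = Pair v ` ?N"
    by (auto simp: out_arcs_def dest: in_arcsD2)
  have d: "vertex_degree G v = card ?N"
    unfolding vertex_degree_def out_degree_def oa by (rule card_image) (auto simp: inj_on_def)
  have s: "(\<Sum>j\<in>pverts G. adjacency G v j) = real (card ?N)"
    using pair_finite_verts by (simp add: adjacency_def sum.If_cases Int_def)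
  have "real (card ?N) \<noteq> 0"
    using assms(2) unfolding d by linarith
  then show ?thesis
    unfolding transition_def sum_divide_distrib[symmetric] d s by (rule div_self)
qed

lemma transition_nonneg: "transition G v j \<ge> 0"
  by (simp add: transition_def adjacency_def)

lemma prob_space_row:
  assumes "pair_graph G" "vertex_degree G v > 0"
  shows "prob_space (point_measure (pverts G) (\<lambda>j. ennreal (transition G v j)))"
proof
  interpret pair_graph G by fact
  show "emeasure (point_measure (pverts G) (\<lambda>j. ennreal (transition G v j)))
      (space (point_measure (pverts G) (\<lambda>j. ennreal (transition G v j)))) = 1"
    using sum_transition[OF assms] pair_finite_verts
    by (simp add: space_point_measure emeasure_point_measure_finite sum_ennreal transition_nonneg)
qed

lemma walk_Suc_shift: "walk i \<omega> (Suc t) = walk (shd \<omega> i) (stl \<omega>) t"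
  by (induction t) auto

lemma measurable_random_map_component:
  assumes "v \<in> pverts G"
  shows "(\<lambda>f. f v) \<in> measurable (random_map G) (count_space (pverts G))"
proof -
  have "(\<lambda>f. f v) \<in> measurable (random_map G)
      (point_measure (pverts G) (\<lambda>j. ennreal (transition G v j)))"
    unfolding random_map_def by (rule measurable_component_singleton[OF assms])
  then show ?thesis
    by (simp cong: measurable_cong_sets add: measurable_def space_point_measure sets_point_measure)
qed

lemma measurable_walk:
  assumes "pair_graph G" "i \<in> pverts G"
  shows "(\<lambda>\<omega>. walk i \<omega> t) \<in> measurable (walk_space G) (count_space (pverts G))"
proof (induction t)
  case 0
  show ?case using assms(2) by simp
next
  case (Suc t)
  interpret pair_graph G by fact
  have "(\<lambda>\<omega>. (\<omega> !! t) v) \<in> measurable (walk_space G) (count_space (pverts G))"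
    if "v \<in> pverts G" for v
    unfolding walk_space_def
    using measurable_compose[OF measurable_snth measurable_random_map_component[OF that]] .
  from measurable_compose_countable'[OF this Suc countable_finite[OF pair_finite_verts]]
  show ?case by simp
qed

lemma random_walk_law:
  assumes G: "pair_graph G" and deg: "\<And>v. v \<in> pverts G \<Longrightarrow> vertex_degree G v > 0"
    and i: "i \<in> pverts G"
  shows "measure (walk_space G) {\<omega> \<in> space (walk_space G). \<forall>t\<le>k. walk i \<omega> t = x t} =
    (if x 0 = i then \<Prod>t<k. transition G (x t) (x (Suc t)) else 0)"
proof -
  interpret pair_graph G by fact
  interpret R: prob_space "random_map G"
    unfolding random_map_def by (intro prob_space_PiM prob_space_row G deg)
  interpret W: prob_space "walk_space G"
    unfolding walk_space_def by (rule R.prob_space_stream_space)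
  have meas: "{\<omega> \<in> space (walk_space G). \<forall>t\<le>k. walk i \<omega> t = x t} \<in> sets (walk_space G)"
    if "i \<in> pverts G" for i x k
  proof -
    have "{\<omega> \<in> space (walk_space G). \<forall>t\<in>{..k}. walk i \<omega> t = x t} \<in> sets (walk_space G)"
    proof (rule sets.sets_Collect_finite_All')
      fix t
      have "(\<lambda>\<omega>. walk i \<omega> t) -` ({x t} \<inter> pverts G) \<inter> space (walk_space G) \<in> sets (walk_space G)"
        by (rule measurable_sets[OF measurable_walk[OF G that]]) auto
      also have "(\<lambda>\<omega>. walk i \<omega> t) -` ({x t} \<inter> pverts G) \<inter> space (walk_space G)
          = {\<omega> \<in> space (walk_space G). walk i \<omega> t = x t}"
        using measurable_space[OF measurable_walk[OF G that, of t]] by auto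
      finally show "{\<omega> \<in> space (walk_space G). walk i \<omega> t = x t} \<in> sets (walk_space G)" .
    qed auto
    then show ?thesis by (simp only: Ball_def atMost_iff)
  qed
  have comp: "emeasure (random_map G) {f \<in> space (random_map G). f v = y} = transition G v y"
    if v: "v \<in> pverts G" for v y
  proof (cases "y \<in> pverts G")
    case True
    let ?P = "point_measure (pverts G) (\<lambda>j. ennreal (transition G v j))"
    have "emeasure (distr (random_map G) ?P (\<lambda>f. f v)) {y} = emeasure ?P {y}"
      unfolding random_map_def by (subst distr_PiM_component[OF prob_space_row[OF G deg] v]) auto
    moreover have "emeasure (distr (random_map G) ?P (\<lambda>f. f v)) {y}
        = emeasure (random_map G) {f \<in> space (random_map G). f v = y}"
    proof (subst emeasure_distr)
      show "(\<lambda>f. f v) \<in> measurable (random_map G) ?P"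
        unfolding random_map_def by (rule measurable_component_singleton[OF v])
      show "{y} \<in> sets ?P"
        using True by (simp add: sets_point_measure)
    qed (auto intro!: arg_cong[where f = "emeasure (random_map G)"])
    ultimately show ?thesis
      using True by (simp add: emeasure_point_measure_finite2)
  next
    case False
    then have "{f \<in> space (random_map G). f v = y} = {}"
      using measurable_space[OF measurable_random_map_component[OF v]] by auto
    moreover have "transition G v y = 0"
      using False by (auto simp: transition_def adjacency_def dest: in_arcsD2)
    ultimately show ?thesis by (simp only: emeasure_empty ennreal_0)
  qed
  have "emeasure (walk_space G) {\<omega> \<in> space (walk_space G). \<forall>t\<le>k. walk i \<omega> t = x t} =
      ennreal (if x 0 = i then \<Prod>t<k. transition G (x t) (x (Suc t)) else 0)"
    using i
  proof (induction k arbitrary: i x)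
    case 0
    then show ?case using W.emeasure_space_1 by auto
  next
    case (Suc k)
    let ?S = "\<lambda>i x k. {\<omega> \<in> space (walk_space G). \<forall>t\<le>k. walk i \<omega> t = x t}"
    let ?c = "\<Prod>t<k. transition G (x (Suc t)) (x (Suc (Suc t)))"
    have c0: "?c \<ge> 0" by (intro prod_nonneg) (auto intro: transition_nonneg)
    show ?case
    proof (cases "x 0 = i")
      case False
      then have "walk i \<omega> 0 \<noteq> x 0" for \<omega> by simp
      then have "?S i x (Suc k) = {}" by blast
      then show ?thesis using False by (simp only: emeasure_empty ennreal_0 if_False)
    next
      case True
      have all: "(\<forall>t\<le>Suc k. P t) \<longleftrightarrow> P 0 \<and> (\<forall>t\<le>k. P (Suc t))" for P
        using All_less_Suc2[of "Suc k" P] by (simp only: less_Suc_eq_le)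
      have "emeasure (walk_space G) (?S i x (Suc k)) =
          (\<integral>\<^sup>+f. emeasure (walk_space G)
             {\<omega> \<in> space (walk_space G). f ## \<omega> \<in> ?S i x (Suc k)} \<partial>random_map G)"
        using R.emeasure_stream_space[OF meas[OF Suc.prems, of "Suc k" x, unfolded walk_space_def]]
        unfolding walk_space_def .
      also have "\<dots> = (\<integral>\<^sup>+f. ennreal ?c *
          indicator {f \<in> space (random_map G). f i = x 1} f \<partial>random_map G)"
      proof (rule nn_integral_cong)
        fix f assume f: "f \<in> space (random_map G)"
        then have fi: "f i \<in> pverts G"
          using measurable_space[OF measurable_random_map_component[OF Suc.prems]] by auto
        have "{\<omega> \<in> space (walk_space G). f ## \<omega> \<in> ?S i x (Suc k)} = ?S (f i) (\<lambda>t. x (Suc t)) k"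
          using True f
          by (auto simp: all walk_Suc_shift walk_space_def stream_space_Stream simp del: walk.simps(2))
        then show "emeasure (walk_space G) {\<omega> \<in> space (walk_space G). f ## \<omega> \<in> ?S i x (Suc k)} =
            ennreal ?c * indicator {f \<in> space (random_map G). f i = x 1} f"
          using Suc.IH[OF fi, of "\<lambda>t. x (Suc t)"] f by (auto simp: indicator_def)
      qed
      also have "\<dots> = ennreal ?c * transition G i (x 1)"
      proof -
        have "{f \<in> space (random_map G). f i = x 1}
            = (\<lambda>f. f i) -` ({x 1} \<inter> pverts G) \<inter> space (random_map G)"
          using measurable_space[OF measurable_random_map_component[OF Suc.prems]] by auto
        also have "\<dots> \<in> sets (random_map G)"
          by (rule measurable_sets[OF measurable_random_map_component[OF Suc.prems]]) auto
        finally show ?thesis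
          using comp[OF Suc.prems] by (simp add: nn_integral_cmult_indicator)
      qed
      also have "\<dots> = ennreal (\<Prod>t<Suc k. transition G (x t) (x (Suc t)))"
        using True c0 transition_nonneg[of G i "x 1"]
        by (simp add: prod.lessThan_Suc_shift ennreal_mult mult.commute del: prod.lessThan_Suc)
      finally show ?thesis using True by simp
    qed
  qed
  then show ?thesis
    by (simp add: measure_def prod_nonneg transition_nonneg)
qed

end

theory Submission
  imports Defs
begin

text \<open>
  Write \<open>d(u,v)\<close> for the distance, \<open>n\<close> for the order, \<open>m = n - 1\<close> for the number of edges and
  \<open>W\<close> for the sum of \<open>d(u,v)\<close> over all ordered pairs. Everything rests on one property of a tree:
  of the neighbours of a vertex \<open>v \<noteq> z\<close>, exactly one is nearer to \<open>z\<close> and all others are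
  farther away (\<open>unique_closer_neighbour\<close>, the only place where acyclicity is used). Equivalently, the graph
  Laplacian of \<open>d(_,z)\<close> is known explicitly (\<open>laplacian_d\<close>).

  \<^bold>\<open>Reduction to distances.\<close> Because of the formula for the Laplacian, the function
  \<open>1/2 * (\<Sum>z. deg z * (d(i,j) + d(j,z) - d(i,z)))\<close>
  satisfies the equations that come from conditioning on the first step of the walk. In any connected graph these
  equations have at most one nonnegative solution, by the maximum principle, and their solution is
  the mean hitting time (\<open>mean_hitting_time_eq\<close>). The stationary distribution is \<open>deg / 2m\<close>, and
  weighting by it makes the two terms that contain the start \<open>i\<close> cancel. So Kemeny's constant is
  \<open>(\<Sum>u v. deg u * deg v * d(u,v)) / 4m\<close>. Summing the Laplacians of \<open>d\<close> and of its square over the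
  graph gives zero, and these two identities eliminate the degrees:
  \<open>\<kappa> = W / m - n + 1/2\<close> (\<open>kemeny_eq_total_dist\<close>).

  \<^bold>\<open>Bounds on \<open>W\<close>.\<close> Take a path \<open>p\<^sub>0, \<dots>, p\<^sub>\<delta>\<close> that realises the diameter. Seen from it, every vertex \<open>v\<close>
  is a branch of some height \<open>h\<close> attached at some \<open>p\<^sub>a\<close>, that is, \<open>d(v, p\<^sub>k) = \<bar>k - a\<bar> + h\<close>
  (\<open>d_profile\<close>), with \<open>h \<le> min a (\<delta> - a)\<close> because no distance exceeds \<open>\<delta>\<close>. The pairs inside the path contribute
  \<open>\<delta>(\<delta>+1)(\<delta>+2)/3\<close> exactly. Each of the \<open>q = n - \<delta> - 1\<close> other vertices is at total distance at most
  \<open>3\<delta>\<^sup>2/4 + \<delta>\<close> from the path, and two of them are at distance at most \<open>\<delta>\<close>; this suffices for the upper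
  bound. For the lower bound, all distinct nonadjacent vertices are at distance at least 2. To count how often
  the distance is 1, add the adjacency matrix to the distance matrix: its total \<open>2m\<close> is
  known, and the sum of the two matrices is at least 2 off the diagonal (\<open>total_dist_lower\<close>).
\<close>

section \<open>Connected graphs and their distance\<close>

definition neighbours :: "'a pair_pre_digraph \<Rightarrow> 'a \<Rightarrow> 'a set" where
  "neighbours G v = {w. (v, w) \<in> parcs G}"

definition hop_dist :: "'a pair_pre_digraph \<Rightarrow> 'a \<Rightarrow> 'a \<Rightarrow> nat" where
  "hop_dist G u v = (LEAST l. \<exists>p. pre_digraph.awalk (with_proj G) u p v \<and> length p = l)"

locale connected_pair_graph = pair_graph G for G :: "'a pair_pre_digraph" +
  assumes connected: "connected (with_proj G)"
begin

abbreviation "V \<equiv> pverts G"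
abbreviation "N \<equiv> neighbours G"
abbreviation "d \<equiv> hop_dist G"
abbreviation "deg v \<equiv> real (card (N v))"

lemma mem_N: "w \<in> N v \<longleftrightarrow> (v, w) \<in> parcs G"
  by (simp add: neighbours_def)

lemma N_subset: "N v \<subseteq> V"
  by (auto simp: neighbours_def dest: in_arcsD2)

lemma N_sym: "w \<in> N v \<longleftrightarrow> v \<in> N w"
  by (auto simp: neighbours_def intro: arcs_symmetric)

lemma not_in_N_self: "v \<notin> N v"
  by (auto simp: neighbours_def dest: no_loops')

lemma N_verts: "w \<in> N v \<Longrightarrow> w \<in> V" "w \<in> N v \<Longrightarrow> v \<in> V"
  using N_subset N_sym by blast+

lemma finite_N [simp]: "finite (N v)"
  using N_subset pair_finite_verts by (rule finite_subset)

lemma V_nonempty: "V \<noteq> {}"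
  using connected by (auto simp: connected_def strongly_connected_def)

lemma vertex_degree_eq_card: "vertex_degree G v = card (N v)"
proof -
  have "out_arcs (with_proj G) v = Pair v ` N v"
    by (auto simp: out_arcs_def neighbours_def)
  then show ?thesis
    unfolding vertex_degree_def out_degree_def by (simp add: card_image inj_on_def)
qed

text \<open>
  Both sides run over all arcs. Applied to \<open>f v w = g w\<close>, the identity says that the Laplacian of any
  function sums to zero over the graph.
\<close>

lemma sum_sum_N_swap:
  fixes f :: "'a \<Rightarrow> 'a \<Rightarrow> 'b::comm_monoid_add"
  shows "(\<Sum>v\<in>V. \<Sum>w\<in>N v. f v w) = (\<Sum>v\<in>V. \<Sum>w\<in>N v. f w v)"
proof -
  have restrict: "sum g (N v) = (\<Sum>w\<in>V. if w \<in> N v then g w else 0)" for g :: "'a \<Rightarrow> 'b" and v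
    using N_subset[of v] by (simp add: sum.inter_restrict[symmetric] Int_absorb1)
  have "(\<Sum>v\<in>V. \<Sum>w\<in>N v. f v w) = (\<Sum>v\<in>V. \<Sum>w\<in>V. if w \<in> N v then f v w else 0)"
    by (simp only: restrict)
  also have "\<dots> = (\<Sum>w\<in>V. \<Sum>v\<in>V. if w \<in> N v then f v w else 0)"
    by (rule sum.swap)
  also have "\<dots> = (\<Sum>w\<in>V. \<Sum>v\<in>V. if v \<in> N w then f v w else 0)"
    by (simp only: N_sym)
  finally show ?thesis
    by (simp only: restrict)
qed

lemma ex_awalk: "u \<in> V \<Longrightarrow> v \<in> V \<Longrightarrow> \<exists>p. awalk u p v"
  using symmetric_connected_imp_strongly_connected[OF pair_sym_arcs connected]
  by (auto simp: strongly_connected_def reachable_awalk)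

text \<open>
  The form in which connectedness enters the maximum principles below: there \<open>S\<close> is the set where
  a function attains its maximum.
\<close>

lemma closed_under_neighbours_eq_V:
  assumes "S \<subseteq> V" "S \<noteq> {}" and closed: "\<And>v. v \<in> S \<Longrightarrow> N v \<subseteq> S"
  shows "S = V"
proof -
  have *: "awalk u p v \<Longrightarrow> u \<in> S \<Longrightarrow> v \<in> S" for u p v
  proof (induction p arbitrary: u)
    case (Cons e p)
    then have "snd e \<in> N u" "awalk (snd e) p v"
      by (auto simp: awalk_Cons_iff mem_N)
    then show ?case
      using Cons.IH Cons.prems(2) closed by blast
  qed (simp add: awalk_Nil_iff)
  then show ?thesis
    using assms(1,2) ex_awalk by blast
qed

lemma N_nonempty:
  assumes "card V \<noteq> 1" "v \<in> V"
  shows "N v \<noteq> {}"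
proof
  assume "N v = {}"
  then have "{v} = V"
    using assms by (intro closed_under_neighbours_eq_V) auto
  then have "card V = 1"
    by (metis is_singletonI is_singleton_altdef)
  with assms show False by simp
qed

lemma shortest_awalk:
  assumes "u \<in> V" "v \<in> V"
  obtains p where "awalk u p v" "length p = d u v"
  using LeastI_ex[of "\<lambda>l. \<exists>p. awalk u p v \<and> length p = l"] ex_awalk[OF assms]
  unfolding hop_dist_def by blast

lemma d_le_length: "awalk u p v \<Longrightarrow> d u v \<le> length p"
  unfolding hop_dist_def by (rule Least_le) auto

lemma d_self: "v \<in> V \<Longrightarrow> d v v = 0"
  using d_le_length[of v "[]" v] by (simp add: awalk_Nil_iff)

lemma d_eq_0_iff: "u \<in> V \<Longrightarrow> v \<in> V \<Longrightarrow> d u v = 0 \<longleftrightarrow> u = v"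
  by (metis d_self shortest_awalk awalk_empty_ends length_0_conv)

lemma d_commute: "u \<in> V \<Longrightarrow> v \<in> V \<Longrightarrow> d u v = d v u"
proof -
  have *: "d v u \<le> d u v" if uv: "u \<in> V" "v \<in> V" for u v
  proof -
    obtain p where "awalk u p v" "length p = d u v"
      using shortest_awalk[OF uv] .
    moreover have "length (rev_path p) = length p"
      by (induction p) auto
    ultimately show ?thesis
      using d_le_length[of v "rev_path p" u] by simp
  qed
  show "u \<in> V \<Longrightarrow> v \<in> V \<Longrightarrow> d u v = d v u"
    by (intro antisym *)
qed

lemma d_neighbour_le:
  assumes "w \<in> N v" "z \<in> V"
  shows "d v z \<le> Suc (d w z)"
proof -
  obtain p where p: "awalk w p z" "length p = d w z"
    using shortest_awalk[of w z] N_verts assms by blast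
  have "awalk v ((v, w) # p) z"
    using p assms by (simp add: awalk_Cons_iff mem_N)
  then show ?thesis
    using d_le_length[of v "(v, w) # p" z] p(2) by simp
qed

lemma ex_closer_neighbour:
  assumes "v \<in> V" "z \<in> V" "v \<noteq> z"
  obtains w where "w \<in> N v" "d v z = Suc (d w z)"
proof -
  obtain p where p: "awalk v p z" "length p = d v z"
    using shortest_awalk[OF assms(1,2)] .
  then obtain e es where e: "p = e # es"
    using assms(3) awalk_empty_ends by (cases p) auto
  then have "e \<in> parcs G" "v = fst e" and aw: "awalk (snd e) es z"
    using p(1) by (auto simp: awalk_Cons_iff)
  then have "snd e \<in> N v"
    by (simp add: mem_N)
  moreover have "d v z = Suc (d (snd e) z)"
    using d_le_length[OF aw] d_neighbour_le[OF \<open>snd e \<in> N v\<close> assms(2)] p(2) e by simp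
  ultimately show ?thesis using that by blast
qed

lemma graph_dist_eq_d:
  assumes "u \<in> V" "v \<in> V"
  shows "graph_dist G u v = ereal (real (d u v))"
proof -
  have cost: "awalk_cost (\<lambda>_. 1) p = real (length p)" for p
    by (induction p) auto
  obtain p where p: "awalk u p v" "length p = d u v"
    using shortest_awalk[OF assms] .
  have "graph_dist G u v \<le> ereal (real (d u v))"
    using min_cost_le_walk_cost[OF p(1), of "\<lambda>_. 1"] p(2) by (simp add: cost graph_dist_def)
  moreover have "ereal (real (d u v)) \<le> graph_dist G u v"
    unfolding graph_dist_def \<mu>_def
    by (intro INF_greatest) (auto simp: cost d_le_length)
  ultimately show ?thesis by (rule antisym)
qed

text \<open>
  A finite graph attains its diameter, so the supremum over the extended reals is an ordinary distance.
\<close>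

lemma obtain_diametral_pair:
  obtains x y where "x \<in> V" "y \<in> V" "real_of_ereal (graph_diameter G) = real (d x y)"
    "\<And>u v. u \<in> V \<Longrightarrow> v \<in> V \<Longrightarrow> d u v \<le> d x y"
proof -
  let ?D = "(\<lambda>(u, v). d u v) ` (V \<times> V)"
  have fin: "finite ?D" "?D \<noteq> {}"
    using V_nonempty by auto
  have "Max ?D \<in> ?D"
    by (rule Max_in[OF fin])
  then obtain x y where xy: "x \<in> V" "y \<in> V" "Max ?D = d x y"
    by auto
  have max: "d u v \<le> d x y" if "u \<in> V" "v \<in> V" for u v
    using Max_ge[OF fin(1), of "d u v"] that xy(3) by auto
  have "graph_diameter G = ereal (real (d x y))"
  proof (rule antisym)
    show "graph_diameter G \<le> ereal (real (d x y))"
      unfolding graph_diameter_def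
      by (intro SUP_least) (simp add: graph_dist_eq_d max)
    show "ereal (real (d x y)) \<le> graph_diameter G"
      unfolding graph_diameter_def graph_dist_eq_d[OF xy(1,2), symmetric]
      by (meson SUP_upper2 SUP_upper xy)
  qed
  then show ?thesis using that xy max by simp
qed

end

section \<open>Mean hitting times by first-step analysis\<close>

text \<open>
  The maximum principle at a single vertex: an average can equal an upper bound of its terms only if
  each of them equals that bound.
\<close>

lemma eq_of_sum_eq_card_mult_bound:
  fixes f :: "'b \<Rightarrow> real"
  assumes "finite A" "\<And>x. x \<in> A \<Longrightarrow> f x \<le> M" "sum f A = real (card A) * M" "x \<in> A"
  shows "f x = M"
proof -
  have "(\<Sum>x\<in>A. M - f x) = 0"
    using assms(3) by (simp add: sum_subtractf)
  then show ?thesis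
    using assms sum_nonneg_eq_0_iff[of A "\<lambda>x. M - f x"] by auto
qed

lemma SUP_min_of_nat_ennreal: "(SUP n. min x (of_nat n)) = (x :: ennreal)"
  using inf_SUP[of x "of_nat :: nat \<Rightarrow> ennreal" UNIV]
  by (simp add: inf_min ennreal_SUP_of_nat_eq_top)

lemma hitting_time_eq_INF:
  "hitting_time i j \<omega> = (INF t. if walk i \<omega> (Suc t) = j then of_nat (Suc t) else \<top>)"
proof (rule antisym)
  show "hitting_time i j \<omega> \<le> (INF t. if walk i \<omega> (Suc t) = j then of_nat (Suc t) else \<top>)"
    unfolding hitting_time_def by (intro INF_greatest) (auto intro!: INF_lower simp del: of_nat_Suc)
  show "(INF t. if walk i \<omega> (Suc t) = j then of_nat (Suc t) else \<top>) \<le> hitting_time i j \<omega>"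
    unfolding hitting_time_def
  proof (rule INF_greatest)
    fix s assume s: "s \<in> {s. 1 \<le> s \<and> walk i \<omega> s = j}"
    then obtain t where "s = Suc t"
      by (cases s) auto
    then show "(INF t. if walk i \<omega> (Suc t) = j then of_nat (Suc t) else \<top>) \<le> (of_nat s :: ennreal)"
      using s by (intro INF_lower2[of t]) (auto simp del: of_nat_Suc walk.simps)
  qed
qed

text \<open>
  The Markov property, pathwise: after the first step the walk starts afresh at \<open>f i\<close>, driven by the
  remaining maps, and it has already arrived if \<open>f i = j\<close>.
\<close>

lemma hitting_time_Stream:
  "hitting_time i j (f ## \<omega>) = 1 + (if f i = j then 0 else hitting_time (f i) j \<omega>)"
proof -
  have eq: "hitting_time i j (f ## \<omega>) = (INF t. if walk (f i) \<omega> t = j then of_nat (Suc t) else \<top>)"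
    by (simp add: hitting_time_eq_INF walk_Suc_shift del: walk.simps of_nat_Suc)
  show ?thesis
  proof (cases "f i = j")
    case True
    have "hitting_time i j (f ## \<omega>) \<le> 1"
      unfolding eq using True by (intro INF_lower2[of 0]) auto
    moreover have "1 \<le> hitting_time i j (f ## \<omega>)"
      unfolding eq by (intro INF_greatest) auto
    ultimately show ?thesis
      using True by (simp add: antisym)
  next
    case False
    have "hitting_time i j (f ## \<omega>)
        = (INF t. 1 + (if walk (f i) \<omega> (Suc t) = j then of_nat (Suc t) else \<top>))" (is "_ = ?R")
    proof (rule antisym)
      show "hitting_time i j (f ## \<omega>) \<le> ?R"
        unfolding eq
      proof (rule INF_greatest)
        fix t
        show "(INF t. if walk (f i) \<omega> t = j then of_nat (Suc t) else \<top>)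
            \<le> (1 + (if walk (f i) \<omega> (Suc t) = j then of_nat (Suc t) else \<top>) :: ennreal)"
          by (intro INF_lower2[of "Suc t"]) (auto simp del: walk.simps)
      qed
      show "?R \<le> hitting_time i j (f ## \<omega>)"
        unfolding eq
      proof (rule INF_greatest)
        fix t
        show "?R \<le> (if walk (f i) \<omega> t = j then of_nat (Suc t) else \<top>)"
        proof (cases t)
          case 0
          then show ?thesis using False by simp
        next
          case (Suc s)
          then show ?thesis
            by (intro INF_lower2[of s]) (auto simp del: walk.simps)
        qed
      qed
    qed
    then show ?thesis
      using False by (simp add: hitting_time_eq_INF INF_ennreal_const_add)
  qed
qed

locale nontrivial_connected_pair_graph = connected_pair_graph +
  assumes nontrivial: "card V \<noteq> 1"
begin

lemma deg_pos: "v \<in> V \<Longrightarrow> 0 < deg v"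
  using N_nonempty[OF nontrivial] by (simp add: card_gt_0_iff)

lemma vertex_degree_pos: "v \<in> V \<Longrightarrow> 0 < vertex_degree G v"
  using deg_pos by (simp add: vertex_degree_eq_card)

lemma transition_eq: "transition G v w = (if w \<in> N v then 1 / deg v else 0)"
  by (simp add: transition_def adjacency_def vertex_degree_eq_card mem_N)

lemma sum_transition_mult: "(\<Sum>w\<in>V. transition G v w * f w) = (\<Sum>w\<in>N v. f w) / deg v"
proof -
  have "(\<Sum>w\<in>V. transition G v w * f w) = (\<Sum>w\<in>V. if w \<in> N v then f w / deg v else 0)"
    by (intro sum.cong) (auto simp: transition_eq)
  also have "\<dots> = (\<Sum>w\<in>N v. f w / deg v)"
    using N_subset[of v] by (simp add: sum.inter_restrict[symmetric] Int_absorb1)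
  finally show ?thesis
    by (simp add: sum_divide_distrib)
qed

lemma prob_space_random_map: "prob_space (random_map G)"
  unfolding random_map_def using vertex_degree_pos
  by (intro prob_space_PiM prob_space_row) (auto simp: pair_graph_axioms)

lemma prob_space_walk_space: "prob_space (walk_space G)"
  unfolding walk_space_def by (rule prob_space.prob_space_stream_space[OF prob_space_random_map])

lemma nn_integral_random_map:
  assumes v: "v \<in> V"
  shows "(\<integral>\<^sup>+ f. g (f v) \<partial>random_map G) = (\<Sum>w\<in>V. ennreal (transition G v w) * g w)"
proof -
  let ?M = "\<lambda>v. point_measure V (\<lambda>w. ennreal (transition G v w))"
  have "(\<integral>\<^sup>+ f. g (f v) \<partial>random_map G) = (\<integral>\<^sup>+ w. g w \<partial>distr (random_map G) (?M v) (\<lambda>f. f v))"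
  proof (rule nn_integral_distr[symmetric])
    show "(\<lambda>f. f v) \<in> measurable (random_map G) (?M v)"
      unfolding random_map_def by (rule measurable_component_singleton[OF v])
    show "g \<in> borel_measurable (distr (random_map G) (?M v) (\<lambda>f. f v))"
      by (simp add: measurable_def space_point_measure sets_point_measure)
  qed
  also have "distr (random_map G) (?M v) (\<lambda>f. f v) = ?M v"
    unfolding random_map_def using vertex_degree_pos
    by (intro distr_PiM_component prob_space_row v) (auto simp: pair_graph_axioms)
  finally show ?thesis
    by (simp add: nn_integral_point_measure_finite)
qed

lemma measurable_hitting_time [measurable]:
  assumes "i \<in> V"
  shows "hitting_time i j \<in> borel_measurable (walk_space G)"
proof -
  have "(\<lambda>\<omega>. if walk i \<omega> (Suc t) = j then of_nat (Suc t) else \<top> :: ennreal)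
      \<in> borel_measurable (walk_space G)" for t
  proof -
    have "(\<lambda>v. if v = j then of_nat (Suc t) else \<top> :: ennreal) \<in> borel_measurable (count_space V)"
      by simp
    from measurable_compose[OF measurable_walk[OF pair_graph_axioms assms, of "Suc t"] this]
    show ?thesis .
  qed
  then have "(\<lambda>\<omega>. INF t. if walk i \<omega> (Suc t) = j then of_nat (Suc t) else \<top> :: ennreal)
      \<in> borel_measurable (walk_space G)"
    by (intro borel_measurable_INF) auto
  then show ?thesis
    by (simp add: hitting_time_eq_INF[abs_def] del: walk.simps of_nat_Suc)
qed

text \<open>
  The truncation at \<open>c\<close> serves two purposes. With \<open>c = \<top>\<close> this is the equation for the mean hitting time
  itself, and with finite \<open>c\<close> it drives an induction which shows that this mean is finite.
\<close>

lemma nn_integral_min_hitting_time_step: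
  assumes i: "i \<in> V"
  shows "(\<integral>\<^sup>+ \<omega>. min (hitting_time i j \<omega>) (1 + c) \<partial>walk_space G) =
    (\<Sum>w\<in>V. ennreal (transition G i w)
       * (1 + (if w = j then 0 else \<integral>\<^sup>+ \<omega>. min (hitting_time w j \<omega>) c \<partial>walk_space G)))"
    (is "_ = (\<Sum>w\<in>V. _ * ?g w)")
proof -
  interpret R: prob_space "random_map G"
    by (rule prob_space_random_map)
  interpret W: prob_space "walk_space G"
    by (rule prob_space_walk_space)
  have "(\<integral>\<^sup>+ \<omega>. min (hitting_time i j \<omega>) (1 + c) \<partial>walk_space G)
      = (\<integral>\<^sup>+ f. (\<integral>\<^sup>+ \<omega>. min (hitting_time i j (f ## \<omega>)) (1 + c) \<partial>walk_space G) \<partial>random_map G)"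
    using measurable_hitting_time[OF i, of j]
    unfolding walk_space_def by (intro R.nn_integral_stream_space) auto
  also have "\<dots> = (\<integral>\<^sup>+ f. ?g (f i) \<partial>random_map G)"
  proof (rule nn_integral_cong)
    fix f assume "f \<in> space (random_map G)"
    then have fi: "f i \<in> V"
      using measurable_space[OF measurable_random_map_component[OF i]] by auto
    have "min (hitting_time i j (f ## \<omega>)) (1 + c)
        = 1 + (if f i = j then 0 else min (hitting_time (f i) j \<omega>) c)" for \<omega>
      by (simp add: hitting_time_Stream min_add_distrib_right min_def)
    then show "(\<integral>\<^sup>+ \<omega>. min (hitting_time i j (f ## \<omega>)) (1 + c) \<partial>walk_space G) = ?g (f i)"
      using measurable_hitting_time[OF fi, of j] by (simp add: nn_integral_add W.emeasure_space_1)
  qed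
  also have "\<dots> = (\<Sum>w\<in>V. ennreal (transition G i w) * ?g w)"
    by (rule nn_integral_random_map[OF i])
  finally show ?thesis .
qed

lemma nn_integral_hitting_time_step:
  assumes i: "i \<in> V"
  shows "(\<integral>\<^sup>+ \<omega>. hitting_time i j \<omega> \<partial>walk_space G) =
    (\<Sum>w\<in>V. ennreal (transition G i w)
       * (1 + (if w = j then 0 else \<integral>\<^sup>+ \<omega>. hitting_time w j \<omega> \<partial>walk_space G)))"
proof -
  have "min x \<top> = x" for x :: ennreal
    by (rule min_absorb1) simp
  then show ?thesis
    using nn_integral_min_hitting_time_step[OF i, of j \<top>] by (simp cong: if_cong)
qed

text \<open>
  These are the equations of \<open>nn_integral_hitting_time_step\<close> over the reals, multiplied by the degree. The
  case \<open>i = j\<close> is included, so \<open>h j\<close> stands for a return time.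
\<close>

definition first_step_solution :: "'a \<Rightarrow> ('a \<Rightarrow> real) \<Rightarrow> bool" where
  "first_step_solution j h \<longleftrightarrow>
     (\<forall>i\<in>V. 0 \<le> h i \<and> deg i * h i = (\<Sum>w\<in>N i. 1 + (if w = j then 0 else h w)))"

text \<open>
  The mean hitting time is the least nonnegative solution: the truncated means grow to it from 0, by
  iteration of a monotone map which fixes \<open>h\<close>. In particular, one real solution suffices to show
  that the mean is finite, without any tail estimate for the walk.
\<close>

lemma nn_integral_hitting_time_le:
  assumes h: "first_step_solution j h" and i: "i \<in> V"
  shows "(\<integral>\<^sup>+ \<omega>. hitting_time i j \<omega> \<partial>walk_space G) \<le> ennreal (h i)"
proof -
  have "(\<integral>\<^sup>+ \<omega>. min (hitting_time i j \<omega>) (of_nat n) \<partial>walk_space G) \<le> ennreal (h i)" for n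
    using i
  proof (induction n arbitrary: i)
    case (Suc n)
    have "(\<integral>\<^sup>+ \<omega>. min (hitting_time i j \<omega>) (of_nat (Suc n)) \<partial>walk_space G) =
        (\<Sum>w\<in>V. ennreal (transition G i w) * (1 + (if w = j then 0
            else \<integral>\<^sup>+ \<omega>. min (hitting_time w j \<omega>) (of_nat n) \<partial>walk_space G)))"
      using nn_integral_min_hitting_time_step[OF Suc.prems, of j "of_nat n"] by simp
    also have "\<dots> \<le> (\<Sum>w\<in>V. ennreal (transition G i w * (1 + (if w = j then 0 else h w))))"
    proof (intro sum_mono)
      fix w assume w: "w \<in> V"
      have "1 + (if w = j then 0 else \<integral>\<^sup>+ \<omega>. min (hitting_time w j \<omega>) (of_nat n) \<partial>walk_space G)
          \<le> ennreal (1 + (if w = j then 0 else h w))"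
        using Suc.IH[OF w] h w by (auto simp: first_step_solution_def)
      then show "ennreal (transition G i w) * (1 + (if w = j then 0
          else \<integral>\<^sup>+ \<omega>. min (hitting_time w j \<omega>) (of_nat n) \<partial>walk_space G))
        \<le> ennreal (transition G i w * (1 + (if w = j then 0 else h w)))"
        by (simp add: ennreal_mult' transition_nonneg mult_left_mono)
    qed
    also have "\<dots> = ennreal (\<Sum>w\<in>V. transition G i w * (1 + (if w = j then 0 else h w)))"
      using h by (intro sum_ennreal mult_nonneg_nonneg transition_nonneg) (auto simp: first_step_solution_def)
    also have "(\<Sum>w\<in>V. transition G i w * (1 + (if w = j then 0 else h w))) = deg i * h i / deg i"
      using h Suc.prems by (simp only: sum_transition_mult first_step_solution_def)
    also have "\<dots> = h i"
      using N_nonempty[OF nontrivial Suc.prems] by simp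
    finally show ?case .
  qed simp
  then have "(SUP n. \<integral>\<^sup>+ \<omega>. min (hitting_time i j \<omega>) (of_nat n) \<partial>walk_space G) \<le> ennreal (h i)"
    by (intro SUP_least)
  moreover have "(SUP n. \<integral>\<^sup>+ \<omega>. min (hitting_time i j \<omega>) (of_nat n) \<partial>walk_space G)
      = (\<integral>\<^sup>+ \<omega>. (SUP n. min (hitting_time i j \<omega>) (of_nat n)) \<partial>walk_space G)"
  proof (rule nn_integral_monotone_convergence_SUP[symmetric])
    show "incseq (\<lambda>n \<omega>. min (hitting_time i j \<omega>) (of_nat n))"
      by (auto simp: incseq_def le_fun_def min_le_iff_disj)
    show "(\<lambda>\<omega>. min (hitting_time i j \<omega>) (of_nat n)) \<in> borel_measurable (walk_space G)" for n
      using measurable_hitting_time[OF i, of j] by auto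
  qed
  ultimately show ?thesis
    by (simp add: SUP_min_of_nat_ennreal)
qed

lemma first_step_solution_mean_hitting_time:
  assumes h: "first_step_solution j h"
  shows "first_step_solution j (\<lambda>i. mean_hitting_time G i j)"
  unfolding first_step_solution_def
proof (intro ballI conjI)
  fix i assume i: "i \<in> V"
  let ?M = "\<lambda>i. mean_hitting_time G i j"
  show nonneg: "0 \<le> ?M i" for i
    by (simp add: mean_hitting_time_def)
  have fin: "(\<integral>\<^sup>+ \<omega>. hitting_time w j \<omega> \<partial>walk_space G) = ennreal (?M w)" if "w \<in> V" for w
    using nn_integral_hitting_time_le[OF h that] unfolding mean_hitting_time_def
    by (metis ennreal_enn2real ennreal_less_top le_less_trans)
  have "ennreal (?M i) = (\<Sum>w\<in>V. ennreal (transition G i w) * (1 + (if w = j then 0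
      else \<integral>\<^sup>+ \<omega>. hitting_time w j \<omega> \<partial>walk_space G)))"
    using nn_integral_hitting_time_step[OF i, of j] by (simp add: fin i)
  also have "\<dots> = (\<Sum>w\<in>V. ennreal (transition G i w * (1 + (if w = j then 0 else ?M w))))"
    by (intro sum.cong refl) (auto simp: fin nonneg transition_nonneg ennreal_mult')
  also have "\<dots> = ennreal (\<Sum>w\<in>V. transition G i w * (1 + (if w = j then 0 else ?M w)))"
    by (intro sum_ennreal mult_nonneg_nonneg transition_nonneg) (auto simp: nonneg)
  also have "\<dots> = ennreal ((\<Sum>w\<in>N i. 1 + (if w = j then 0 else ?M w)) / deg i)"
    by (simp only: sum_transition_mult)
  finally have "?M i = (\<Sum>w\<in>N i. 1 + (if w = j then 0 else ?M w)) / deg i"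
    by (subst (asm) ennreal_inj) (auto intro!: divide_nonneg_nonneg sum_nonneg simp: nonneg)
  then show "deg i * ?M i = (\<Sum>w\<in>N i. 1 + (if w = j then 0 else ?M w))"
    using deg_pos[OF i] by (simp add: field_simps)
qed

text \<open>
  The difference \<open>u\<close> of two solutions is at each vertex the average of \<open>u\<close> over the neighbours, with \<open>u\<close> replaced by 0 at
  \<open>j\<close>. Were its maximum positive, all neighbours of a maximiser would be maximisers other than \<open>j\<close>;
  by connectedness all vertices would be maximisers, and \<open>j\<close> itself is a neighbour of one of them.
\<close>

lemma first_step_solution_le:
  assumes h: "first_step_solution j h" and h': "first_step_solution j h'" and i: "i \<in> V" and j: "j \<in> V"
  shows "h i \<le> h' i"
proof (rule ccontr)
  assume "\<not> h i \<le> h' i"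
  define u where "u i = h i - h' i" for i
  define M where "M = Max (u ` V)"
  have u_le: "u v \<le> M" if "v \<in> V" for v
    unfolding M_def using that by (intro Max_ge) auto
  have M_pos: "0 < M"
    using u_le[OF i] \<open>\<not> h i \<le> h' i\<close> by (simp add: u_def)
  have nbrs: "w \<noteq> j \<and> u w = M" if v: "v \<in> V" "u v = M" and w: "w \<in> N v" for v w
  proof -
    have "(\<Sum>w\<in>N v. if w = j then 0 else u w)
        = (\<Sum>w\<in>N v. (1 + (if w = j then 0 else h w)) - (1 + (if w = j then 0 else h' w)))"
      by (intro sum.cong) (auto simp: u_def)
    also have "\<dots> = deg v * h v - deg v * h' v"
      using h h' v(1) by (simp only: sum_subtractf first_step_solution_def)
    also have "\<dots> = deg v * M"
      using v(2) by (simp add: u_def algebra_simps)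
    finally have "(if w = j then 0 else u w) = M"
      by (rule eq_of_sum_eq_card_mult_bound[OF finite_N, rotated]) (use M_pos u_le N_verts w in auto)
    then show ?thesis
      using M_pos by (auto split: if_splits)
  qed
  have "M \<in> u ` V"
    unfolding M_def using V_nonempty by (intro Max_in) auto
  then have "{v \<in> V. u v = M} = V"
    using nbrs N_verts by (intro closed_under_neighbours_eq_V) auto
  then have uM: "u v = M" if "v \<in> V" for v
    using that by blast
  obtain v where "v \<in> N j"
    using N_nonempty[OF nontrivial j] by blast
  then have "v \<in> V" "j \<in> N v"
    using N_verts N_sym by blast+
  then show False
    using nbrs uM by blast
qed

lemma mean_hitting_time_eq:
  assumes "first_step_solution j h" "i \<in> V" "j \<in> V"
  shows "mean_hitting_time G i j = h i"
  using first_step_solution_le[OF assms(1) first_step_solution_mean_hitting_time[OF assms(1)] assms(2,3)]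
    first_step_solution_le[OF first_step_solution_mean_hitting_time[OF assms(1)] assms]
  by simp

abbreviation total_deg :: real where
  "total_deg \<equiv> \<Sum>v\<in>V. deg v"

lemma total_deg_pos: "0 < total_deg"
  using deg_pos V_nonempty by (intro sum_pos) auto

lemma stationary_flow:
  assumes "j \<in> V"
  shows "(\<Sum>i\<in>V. w i * transition G i j) = (\<Sum>i\<in>N j. w i / deg i)"
proof -
  have "(\<Sum>i\<in>V. w i * transition G i j) = (\<Sum>i\<in>V. if i \<in> N j then w i / deg i else 0)"
    by (intro sum.cong) (auto simp: transition_eq N_sym)
  also have "\<dots> = (\<Sum>i\<in>N j. w i / deg i)"
    using N_subset[of j] by (simp add: sum.inter_restrict[symmetric] Int_absorb1)
  finally show ?thesis .
qed

text \<open>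
  In terms of \<open>u = w / deg\<close>, stationarity says that \<open>u\<close> at each vertex is the average of \<open>u\<close> over the
  neighbours. By the maximum principle \<open>u\<close> is constant, and normalisation determines the constant.
\<close>

lemma stationary_eq:
  assumes "v \<in> V"
  shows "stationary G v = deg v / total_deg"
proof -
  let ?w = "\<lambda>v. if v \<in> V then deg v / total_deg else 0"
  have "is_stationary G ?w"
    unfolding is_stationary_def
  proof (intro conjI ballI)
    fix j assume j: "j \<in> V"
    have "(\<Sum>i\<in>N j. ?w i / deg i) = (\<Sum>i\<in>N j. 1 / total_deg)"
      using deg_pos N_verts by (intro sum.cong refl) (fastforce simp: divide_simps)
    then show "(\<Sum>i\<in>V. ?w i * transition G i j) = ?w j"
      using j by (simp only: stationary_flow) simp
    show "0 < ?w j"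
      using j deg_pos total_deg_pos by simp
  next
    show "(\<Sum>j\<in>V. ?w j) = 1"
      using total_deg_pos by (simp add: sum_divide_distrib[symmetric])
  qed auto
  moreover have "w = ?w" if w: "is_stationary G w" for w
  proof -
    define u where "u i = w i / deg i" for i
    define M where "M = Max (u ` V)"
    have u_le: "u v \<le> M" if "v \<in> V" for v
      unfolding M_def using that by (intro Max_ge) auto
    have nbrs: "u i = M" if j: "j \<in> V" "u j = M" and i: "i \<in> N j" for i j
    proof -
      have "(\<Sum>i\<in>N j. u i) = w j"
        using w j(1) by (simp add: is_stationary_def stationary_flow u_def)
      also have "\<dots> = deg j * M"
        using N_nonempty[OF nontrivial j(1)] j(2)[symmetric] by (simp add: u_def)
      finally have "(\<Sum>i\<in>N j. u i) = deg j * M" .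
      then show ?thesis
        by (rule eq_of_sum_eq_card_mult_bound[OF finite_N, rotated]) (use u_le N_verts i in auto)
    qed
    have "M \<in> u ` V"
      unfolding M_def using V_nonempty by (intro Max_in) auto
    then have "{v \<in> V. u v = M} = V"
      using nbrs N_verts by (intro closed_under_neighbours_eq_V) auto
    then have uM: "u v = M" if "v \<in> V" for v
      using that by blast
    have w_eq: "w v = deg v * M" if "v \<in> V" for v
      using N_nonempty[OF nontrivial that] uM[OF that, symmetric] by (simp add: u_def)
    then have "1 = total_deg * M"
      using w by (simp add: is_stationary_def sum_distrib_right)
    then have "M = 1 / total_deg"
      using total_deg_pos by (simp add: field_simps)
    then show ?thesis
      using w_eq w by (auto simp: is_stationary_def fun_eq_iff)
  qed
  ultimately have "stationary G = ?w"
    unfolding stationary_def by (intro the_equality) blast+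
  then show ?thesis
    using assms by simp
qed

lemma kemeny_eqI:
  assumes "\<And>i. i \<in> V \<Longrightarrow> (\<Sum>j\<in>V. mean_hitting_time G i j * (deg j / total_deg)) - 1 = c"
  shows "kemeny G = c"
proof -
  have "(\<Sum>j\<in>V. mean_hitting_time G i j * stationary G j) - 1 = c" if "i \<in> V" for i
    using assms[OF that] by (simp add: stationary_eq cong: sum.cong)
  then show ?thesis
    unfolding kemeny_def using nontrivial V_nonempty
    by (auto intro!: the_equality)
qed

end

section \<open>The distance in a tree\<close>

locale undirected_tree = connected_pair_graph +
  assumes acyclic: "cycle p \<Longrightarrow> length p < 3"

lemma undirected_tree_iff: "undirected_tree G \<longleftrightarrow> is_tree G"
  unfolding is_tree_def undirected_tree_def undirected_tree_axioms_def
    connected_pair_graph_def connected_pair_graph_axioms_def by (auto simp: not_le)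

context undirected_tree
begin

text \<open>
  A shortest walk to \<open>z\<close> from a neighbour of \<open>i\<close> that is not farther from \<open>z\<close> than \<open>i\<close> is too short
  to pass through \<open>i\<close>. Two such neighbours \<open>a\<close> and \<open>b\<close> are therefore connected by a path that avoids \<open>i\<close>, and
  the edges from \<open>i\<close> to \<open>a\<close> and \<open>b\<close> close it to a cycle.
\<close>

lemma unique_closer_neighbour:
  assumes z: "z \<in> V" "i \<noteq> z" and a: "a \<in> N i" "d a z \<le> d i z" and b: "b \<in> N i" "d b z \<le> d i z"
  shows "a = b"
proof (rule ccontr)
  assume "a \<noteq> b"
  have avoid: "\<exists>p. awalk c p z \<and> i \<notin> set (awalk_verts c p)"
    if c: "c \<in> N i" "d c z \<le> d i z" for c
  proof -
    obtain p where p: "awalk c p z" "length p = d c z"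
      using shortest_awalk[of c z] N_verts c z by blast
    have "i \<notin> set (awalk_verts c p)"
    proof
      assume "i \<in> set (awalk_verts c p)"
      then obtain q r where qr: "p = q @ r" "awalk c q i" "awalk i r z"
        using awalk_decomp[OF p(1)] by blast
      have "q \<noteq> []"
        using qr(2) c(1) not_in_N_self awalk_empty_ends by blast
      then show False
        using d_le_length[OF qr(3)] p(2) qr(1) c(2) by (cases q) auto
    qed
    then show ?thesis using p by blast
  qed
  obtain p where p: "awalk a p z" "i \<notin> set (awalk_verts a p)"
    using avoid[OF a] by blast
  obtain q where q: "awalk b q z" "i \<notin> set (awalk_verts b q)"
    using avoid[OF b] by blast
  define r where "r = p @ rev_path q"
  have r: "awalk a r b"
    unfolding r_def using p(1) q(1) by (intro awalk_appendI) auto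
  have ir: "i \<notin> set (awalk_verts a r)"
    unfolding r_def using set_awalk_verts_append[OF p(1), of "rev_path q" b] p q
    by (simp add: awalk_verts_rev_path[OF q(1), simplified])
  define s where "s = awalk_to_apath r"
  have s: "apath a s b"
    unfolding s_def by (rule apath_awalk_to_apath[OF r])
  have sw: "awalk a s b" "distinct (awalk_verts a s)"
    using s by (auto simp: apath_def)
  have i_s: "i \<notin> set (awalk_verts a s)"
    using ir awalk_to_apath_subset[OF r] set_awalk_verts[OF r] set_awalk_verts[OF sw(1)]
    unfolding s_def by auto
  have "s \<noteq> []"
    using sw(1) \<open>a \<noteq> b\<close> awalk_empty_ends by blast
  let ?c = "(i, a) # s @ [(b, i)]"
  have "awalk b [(b, i)] i"
    using b(1) N_verts by (auto simp: awalk_simps mem_N N_sym[of b i, unfolded mem_N] intro: arcs_symmetric)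
  then have sb: "awalk a (s @ [(b, i)]) i"
    by (rule awalk_appendI[OF sw(1)])
  then have "awalk i ?c i"
    using a(1) sw(1) by (simp add: awalk_Cons_iff mem_N)
  moreover have "distinct (tl (awalk_verts i ?c))"
    using sw(2) i_s awalk_verts_append[OF sb] by simp
  ultimately have "cycle ?c"
    unfolding cycle_def by blast
  then have "length ?c < 3"
    by (rule acyclic)
  then show False
    using \<open>s \<noteq> []\<close> by (cases s) auto
qed

text \<open>
  Among the neighbours of \<open>v\<close>, only the unique nearer one fails to be farther from \<open>z\<close>, and for
  \<open>v = z\<close> there is none.
\<close>

lemma d_neighbour_cases:
  assumes "w \<in> N v" "z \<in> V"
  shows "d w z = Suc (d v z) \<or> d v z = Suc (d w z)"
proof (cases "v = z")
  case True
  have "d w z \<noteq> 0"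
    using assms True not_in_N_self N_verts d_eq_0_iff by blast
  moreover have "d w z \<le> Suc (d v z)"
    using assms N_sym d_neighbour_le by blast
  ultimately show ?thesis
    using True assms d_self by simp
next
  case False
  have v: "v \<in> V"
    using assms N_verts by blast
  obtain c where c: "c \<in> N v" "d v z = Suc (d c z)"
    using ex_closer_neighbour[OF v assms(2) False] .
  have "d w z \<le> Suc (d v z)"
    using assms N_sym d_neighbour_le by blast
  moreover have "w = c" if "d w z \<le> d v z"
    using unique_closer_neighbour[OF assms(2) False assms(1) that c(1)] c(2) by simp
  ultimately show ?thesis
    using c by (cases "d w z \<le> d v z") auto
qed

lemma sum_neighbours_d:
  fixes f :: "nat \<Rightarrow> real"
  assumes "v \<in> V" "z \<in> V"
  shows "(\<Sum>w\<in>N v. f (d w z)) = deg v * f (Suc (d v z))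
    + (if v = z then 0 else f (d v z - 1) - f (Suc (d v z)))"
proof (cases "v = z")
  case True
  have "d w z = Suc (d v z)" if "w \<in> N v" for w
    using d_neighbour_cases[OF that assms(2)] d_self assms True by auto
  then show ?thesis
    using True by simp
next
  case False
  obtain c where c: "c \<in> N v" "d v z = Suc (d c z)"
    using ex_closer_neighbour[OF assms False] .
  have "d w z = Suc (d v z)" if "w \<in> N v - {c}" for w
    using d_neighbour_cases[of w v z] unique_closer_neighbour[OF assms(2) False, of w c] that c assms
    by fastforce
  then have "(\<Sum>w\<in>N v - {c}. f (d w z)) = (\<Sum>w\<in>N v - {c}. f (Suc (d v z)))"
    by (intro sum.cong) auto
  moreover have "card (N v) \<ge> 1"
    using c(1) by (metis One_nat_def Suc_leI card_gt_0_iff empty_iff finite_N)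
  ultimately show ?thesis
    using c False by (simp add: sum.remove[of _ c] card_Diff_singleton of_nat_diff algebra_simps)
qed

text \<open>
  One neighbour contributes \<open>-1\<close> and the others \<open>+1\<close>, except that at \<open>z\<close> all contribute \<open>+1\<close>; the
  last term corrects for this.
\<close>

lemma laplacian_d:
  assumes "v \<in> V" "z \<in> V"
  shows "(\<Sum>w\<in>N v. real (d w z)) = deg v * real (d v z) + deg v - 2 + (if v = z then 2 else 0)"
proof (cases "v = z")
  case False
  then have "d v z \<noteq> 0"
    using assms by (simp add: d_eq_0_iff)
  then show ?thesis
    using sum_neighbours_d[OF assms, of real] False by (simp add: algebra_simps of_nat_diff)
qed (use sum_neighbours_d[OF assms, of real] in \<open>simp add: algebra_simps\<close>)

text \<open>
  Here no correction at \<open>z\<close> is needed, as \<open>(d - 1)\<^sup>2\<close> and \<open>(d + 1)\<^sup>2\<close> agree for \<open>d = 0\<close>.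
\<close>

lemma laplacian_d_square:
  assumes "v \<in> V" "z \<in> V"
  shows "(\<Sum>w\<in>N v. (real (d w z))\<^sup>2) = deg v * (real (d v z))\<^sup>2 + 2 * (deg v - 2) * real (d v z) + deg v"
proof (cases "v = z")
  case False
  then have "d v z \<noteq> 0"
    using assms by (simp add: d_eq_0_iff)
  then show ?thesis
    using sum_neighbours_d[OF assms, of "\<lambda>k. (real k)\<^sup>2"] False
    by (simp add: algebra_simps of_nat_diff power2_eq_square)
qed (use sum_neighbours_d[OF assms, of "\<lambda>k. (real k)\<^sup>2"] d_self[OF assms(2)] in \<open>simp add: algebra_simps\<close>)

lemma sum_sum_neighbours_d:
  fixes f :: "nat \<Rightarrow> real"
  shows "(\<Sum>v\<in>V. \<Sum>w\<in>N v. f (d w z)) = (\<Sum>v\<in>V. deg v * f (d v z))"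
  by (subst sum_sum_N_swap) simp

text \<open>
  The number of edges, obtained from the fact that the Laplacian of \<open>d(_,z)\<close> sums to zero.
\<close>

lemma sum_deg: "(\<Sum>v\<in>V. deg v) = 2 * (real (card V) - 1)"
proof -
  obtain z where z: "z \<in> V"
    using V_nonempty by blast
  have "(\<Sum>v\<in>V. deg v * real (d v z))
      = (\<Sum>v\<in>V. deg v * real (d v z) + deg v - 2 + (if v = z then 2 else 0))"
    unfolding sum_sum_neighbours_d[of real, symmetric]
    by (intro sum.cong refl laplacian_d z)
  then show ?thesis
    using z by (simp add: sum.distrib sum_subtractf)
qed

text \<open>
  The Laplacian of the square of \<open>d(_,z)\<close> sums to zero. Since \<open>deg v\<close> occurs there multiplied by \<open>d(v,z)\<close>,
  this trades one weight by degree for a plain sum; applying it in both arguments gives \<open>sum_deg_deg_d\<close>.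
\<close>

lemma sum_deg_d:
  assumes "z \<in> V"
  shows "(\<Sum>v\<in>V. deg v * real (d v z)) = 2 * (\<Sum>v\<in>V. real (d v z)) - (real (card V) - 1)"
proof -
  have "(\<Sum>v\<in>V. deg v * (real (d v z))\<^sup>2)
      = (\<Sum>v\<in>V. deg v * (real (d v z))\<^sup>2 + 2 * (deg v - 2) * real (d v z) + deg v)"
    unfolding sum_sum_neighbours_d[of "\<lambda>k. (real k)\<^sup>2", symmetric]
    by (intro sum.cong refl laplacian_d_square assms)
  also have "\<dots> = (\<Sum>v\<in>V. deg v * (real (d v z))\<^sup>2) + 2 * (\<Sum>v\<in>V. deg v * real (d v z))
      - 4 * (\<Sum>v\<in>V. real (d v z)) + (\<Sum>v\<in>V. deg v)"
    by (simp add: sum.distrib sum_subtractf sum_distrib_left algebra_simps)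
  finally show ?thesis
    by (simp add: sum_deg)
qed

abbreviation total_dist :: real where
  "total_dist \<equiv> \<Sum>u\<in>V. \<Sum>v\<in>V. real (d u v)"

lemma sum_deg_deg_d:
  defines "m \<equiv> real (card V) - 1"
  shows "(\<Sum>u\<in>V. \<Sum>v\<in>V. deg u * deg v * real (d u v)) = 4 * total_dist - 2 * m * real (card V) - 2 * m\<^sup>2"
proof -
  have "(\<Sum>u\<in>V. \<Sum>v\<in>V. deg u * deg v * real (d u v)) = (\<Sum>v\<in>V. deg v * (\<Sum>u\<in>V. deg u * real (d u v)))"
    by (subst sum.swap) (simp add: sum_distrib_left algebra_simps)
  also have "\<dots> = (\<Sum>v\<in>V. deg v * (2 * (\<Sum>u\<in>V. real (d u v)) - m))"
    unfolding m_def by (intro sum.cong refl) (simp add: sum_deg_d)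
  also have "\<dots> = 2 * (\<Sum>u\<in>V. \<Sum>v\<in>V. deg v * real (d u v)) - m * (\<Sum>v\<in>V. deg v)"
    by (subst sum.swap) (simp add: sum_distrib_left sum_subtractf algebra_simps)
  also have "(\<Sum>u\<in>V. \<Sum>v\<in>V. deg v * real (d u v)) = (\<Sum>u\<in>V. 2 * (\<Sum>v\<in>V. real (d u v)) - m)"
  proof (intro sum.cong refl)
    fix u assume u: "u \<in> V"
    have "(\<Sum>v\<in>V. deg v * real (d u v)) = (\<Sum>v\<in>V. deg v * real (d v u))"
      by (intro sum.cong refl) (simp add: d_commute u)
    also have "\<dots> = 2 * (\<Sum>v\<in>V. real (d u v)) - m"
      unfolding sum_deg_d[OF u] m_def by (simp add: d_commute[OF _ u] cong: sum.cong)
    finally show "(\<Sum>v\<in>V. deg v * real (d u v)) = 2 * (\<Sum>v\<in>V. real (d u v)) - m" .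
  qed
  also have "\<dots> = 2 * total_dist - m * real (card V)"
    by (simp add: sum_subtractf sum_distrib_left)
  finally show ?thesis
    by (simp add: sum_deg m_def power2_eq_square algebra_simps)
qed

text \<open>
  Once a path without backtracking moves away from \<open>z\<close> it never approaches \<open>z\<close> again: the vertex it
  comes from is the unique neighbour nearer to \<open>z\<close>.
\<close>

lemma d_grows_along_path:
  fixes q :: "nat \<Rightarrow> 'a"
  assumes z: "z \<in> V"
    and q: "\<And>k. k < M \<Longrightarrow> q (Suc k) \<in> N (q k)"
    and no_return: "\<And>k. Suc k < M \<Longrightarrow> q (Suc (Suc k)) \<noteq> q k"
    and first: "0 < M \<Longrightarrow> d (q 0) z \<le> d (q 1) z"
    and "t \<le> M"
  shows "d (q t) z = d (q 0) z + t"
  using \<open>t \<le> M\<close>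
proof (induction t rule: less_induct)
  case (less t)
  consider "t = 0" | "t = 1" | (two_steps) s where "t = Suc (Suc s)"
    by (metis One_nat_def not0_implies_Suc)
  then show ?case
  proof cases
    case 2
    then show ?thesis
      using d_neighbour_cases[OF q z, of 0] first less.prems by auto
  next
    case two_steps
    have ds: "d (q (Suc s)) z = d (q 0) z + Suc s" "d (q s) z = d (q 0) z + s"
      using less.IH[of "Suc s"] less.IH[of s] less.prems two_steps by auto
    have nz: "q (Suc s) \<noteq> z"
      using ds(1) d_self[OF z] by auto
    have toward_z: "q s \<in> N (q (Suc s))"
      using q[of s] less.prems two_steps N_sym by auto
    have fwd: "q t \<in> N (q (Suc s))"
      using q[of "Suc s"] less.prems two_steps by auto
    have "q t \<noteq> q s"
      using no_return[of s] less.prems two_steps by auto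
    then have "\<not> d (q t) z \<le> d (q (Suc s)) z"
      using unique_closer_neighbour[OF z nz fwd _ toward_z] ds by auto
    then show ?thesis
      using d_neighbour_cases[OF fwd z] ds two_steps by auto
  qed simp
qed

end

section \<open>Bounds for the sum of all distances\<close>

lemma sum_abs_diff_from:
  assumes "a \<le> L"
  shows "(\<Sum>k\<le>L. \<bar>real k - real a\<bar>) = ((real a)\<^sup>2 + (real L - real a)\<^sup>2 + real L) / 2"
  using assms
proof (induction L rule: dec_induct)
  case base
  have "(\<Sum>k\<le>m. \<bar>real k - real a\<bar>) = real a * (real m + 1) - real m * (real m + 1) / 2"
    if "m \<le> a" for m
    using that by (induction m) (auto simp: field_simps)
  from this[of a] show ?case
    by (simp add: power2_eq_square field_simps)
next
  case (step L)
  then show ?case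
    by (simp add: power2_eq_square field_simps)
qed

lemma sum_sum_abs_diff:
  "(\<Sum>j\<le>L. \<Sum>k\<le>L. \<bar>real k - real j\<bar>) = real L * (real L + 1) * (real L + 2) / 3"
proof -
  have "(\<Sum>j\<le>M. ((real j)\<^sup>2 + (l - real j)\<^sup>2 + l) / 2) =
      real M * (real M + 1) * (2 * real M + 1) / 6 - l * real M * (real M + 1) / 2
        + (real M + 1) * (l\<^sup>2 + l) / 2" for M l
    by (induction M) (simp_all add: power2_eq_square field_simps)
  from this[of "real L" L] show ?thesis
    by (simp add: sum_abs_diff_from power2_eq_square field_simps)
qed

lemma sum_sum_consecutive:
  "(\<Sum>j\<le>L. \<Sum>k\<le>L. of_bool (k = Suc j) + of_bool (j = Suc k) :: real) = 2 * real L"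
proof -
  have *: "(\<Sum>j\<le>L. \<Sum>k\<le>L. of_bool (k = Suc j) :: real) = real L"
  proof -
    have "(\<Sum>k\<le>L. of_bool (k = Suc j) :: real) = of_bool (j < L)" for j
      by (auto simp: of_bool_def)
    moreover have "(\<Sum>j<M. of_bool (j < L) :: real) = real (min L M)" for M
      by (induction M) (auto simp: min_def of_bool_def)
    from this[of "Suc L"] have "(\<Sum>j\<le>L. of_bool (j < L) :: real) = real L"
      by (simp only: lessThan_Suc_atMost min_def) simp
    ultimately show ?thesis by simp
  qed
  moreover have "(\<Sum>j\<le>L. \<Sum>k\<le>L. of_bool (j = Suc k) :: real)
      = (\<Sum>j\<le>L. \<Sum>k\<le>L. of_bool (k = Suc j))"
    by (rule sum.swap)
  ultimately show ?thesis
    by (simp add: sum.distrib)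
qed

lemma sum_sum_distinct:
  assumes "finite A"
  shows "(\<Sum>u\<in>A. \<Sum>v\<in>A. if u = v then 0 else c) = real (card A) * (real (card A) - 1) * c"
proof -
  have "(\<Sum>v\<in>A. if u = v then 0 else c) = (real (card A) - 1) * c" if "u \<in> A" for u
  proof -
    have "(\<Sum>v\<in>A. if u = v then 0 else c) = (\<Sum>v\<in>A. c - (if u = v then c else 0))"
      by (intro sum.cong) auto
    then show ?thesis
      using that assms by (simp add: sum_subtractf algebra_simps)
  qed
  then show ?thesis by simp
qed

lemma sum_sum_split_symmetric:
  fixes f :: "'a \<Rightarrow> 'a \<Rightarrow> real"
  assumes "finite V" "P \<subseteq> V" and sym: "\<And>u v. u \<in> V \<Longrightarrow> v \<in> V \<Longrightarrow> f u v = f v u"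
  shows "(\<Sum>u\<in>V. \<Sum>v\<in>V. f u v) =
    (\<Sum>u\<in>P. \<Sum>v\<in>P. f u v) + 2 * (\<Sum>v\<in>V - P. \<Sum>u\<in>P. f v u) + (\<Sum>u\<in>V - P. \<Sum>v\<in>V - P. f u v)"
proof -
  have split: "sum g V = sum g P + sum g (V - P)" for g :: "'a \<Rightarrow> real"
    using sum.subset_diff[OF assms(2,1), of g] by simp
  have "(\<Sum>u\<in>P. \<Sum>v\<in>V - P. f u v) = (\<Sum>v\<in>V - P. \<Sum>u\<in>P. f u v)"
    by (rule sum.swap)
  also have "\<dots> = (\<Sum>v\<in>V - P. \<Sum>u\<in>P. f v u)"
    using assms(2) by (intro sum.cong refl sym) auto
  finally show ?thesis
    by (simp add: split sum.distrib)
qed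

text \<open>
  A path of distinct vertices in a tree is a geodesic, so injectivity is all that is asked of \<open>p\<close> besides its
  steps. The assumption \<open>L_max\<close> says that \<open>L\<close> bounds the diameter, which is then equal to \<open>L\<close>.
\<close>

locale diametral_path = undirected_tree +
  fixes p :: "nat \<Rightarrow> 'a" and L :: nat
  assumes step: "k < L \<Longrightarrow> p (Suc k) \<in> N (p k)"
    and p_V: "k \<le> L \<Longrightarrow> p k \<in> V"
    and inj: "inj_on p {..L}"
    and L_max: "u \<in> V \<Longrightarrow> v \<in> V \<Longrightarrow> d u v \<le> L"
begin

text \<open>
  Here \<open>p a\<close> is a vertex of the path that is nearest to \<open>z\<close>. Its neighbours on the path are farther from \<open>z\<close>, so
  in both directions the distance to \<open>z\<close> keeps growing by 1 in each step.
\<close>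

lemma d_profile:
  assumes z: "z \<in> V"
  obtains a h where "a \<le> L" "\<And>k. k \<le> L \<Longrightarrow> real (d (p k) z) = \<bar>real k - real a\<bar> + real h"
proof -
  obtain a where a: "a \<le> L" and a_min: "\<And>k. k \<le> L \<Longrightarrow> d (p a) z \<le> d (p k) z"
    using ex_min_if_finite[of "(\<lambda>k. d (p k) z) ` {..L}"]
    by (auto simp: not_less)
  have inj': "p j \<noteq> p k" if "j \<le> L" "k \<le> L" "j \<noteq> k" for j k
    using inj_onD[OF inj, of j k] that by auto
  have fwd: "d (p (a + t)) z = d (p a) z + t" if "t \<le> L - a" for t
    using that
    by (intro d_grows_along_path[where q = "\<lambda>t. p (a + t)" and M = "L - a", OF z, simplified])
      (use inj' in \<open>auto intro!: step a_min\<close>)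
  have bwd: "d (p (a - t)) z = d (p a) z + t" if "t \<le> a" for t
  proof (rule d_grows_along_path[where q = "\<lambda>t. p (a - t)" and M = a, OF z, simplified])
    fix k assume k: "k < a"
    have "p (Suc (a - Suc k)) \<in> N (p (a - Suc k))"
      using k a by (intro step) auto
    then show "p (a - Suc k) \<in> N (p (a - k))"
      using k N_sym by (simp add: Suc_diff_Suc)
  qed (use a that inj' in \<open>auto intro!: a_min\<close>)
  have "real (d (p k) z) = \<bar>real k - real a\<bar> + real (d (p a) z)" if "k \<le> L" for k
    using fwd[of "k - a"] bwd[of "a - k"] that by (cases "a \<le> k") auto
  then show ?thesis
    using that a by blast
qed

definition "P = p ` {..L}"

lemma P_V: "P \<subseteq> V"
  by (auto simp: P_def p_V)

lemma sum_P: "sum f P = (\<Sum>k\<le>L. f (p k))"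
  unfolding P_def using inj by (simp add: sum.reindex)

lemma d_p:
  assumes "j \<le> L" "k \<le> L"
  shows "real (d (p k) (p j)) = \<bar>real k - real j\<bar>"
proof -
  obtain a h where ah: "a \<le> L" "\<And>k. k \<le> L \<Longrightarrow> real (d (p k) (p j)) = \<bar>real k - real a\<bar> + real h"
    using d_profile[OF p_V[OF assms(1)]] by blast
  have "h = 0 \<and> a = j"
    using ah(2)[OF assms(1)] d_self[OF p_V[OF assms(1)]] by auto
  then show ?thesis
    using ah(2)[OF assms(2)] by simp
qed

definition "Q = V - P"

text \<open>
  The two bounds on \<open>h\<close> are the diameter bound for the distances from \<open>v\<close> to the ends of the path.
\<close>

lemma d_profile_off_path:
  assumes "v \<in> Q"
  obtains a h where "a + h \<le> L" "h \<le> a" "1 \<le> h"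
    "\<And>k. k \<le> L \<Longrightarrow> real (d v (p k)) = \<bar>real k - real a\<bar> + real h"
proof -
  have v: "v \<in> V" "v \<notin> P"
    using assms by (auto simp: Q_def)
  obtain a h where ah: "a \<le> L" "\<And>k. k \<le> L \<Longrightarrow> real (d (p k) v) = \<bar>real k - real a\<bar> + real h"
    using d_profile[OF v(1)] by blast
  have "h \<noteq> 0"
  proof
    assume "h = 0"
    then have "d (p a) v = 0"
      using ah(2)[OF ah(1)] by simp
    then have "v = p a"
      using d_eq_0_iff[OF p_V v(1)] ah(1) by simp
    then show False
      using v(2) ah(1) by (auto simp: P_def)
  qed
  moreover have "a + h \<le> L"
    using ah(2)[of 0] L_max[OF p_V[of 0] v(1)] by auto
  moreover have "h \<le> a"
    using ah(2)[of L] ah(1) L_max[OF p_V[of L] v(1)] by auto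
  moreover have "real (d v (p k)) = \<bar>real k - real a\<bar> + real h" if "k \<le> L" for k
    using ah(2)[OF that] d_commute[OF v(1) p_V[OF that]] by simp
  ultimately show ?thesis
    using that[of a h] by simp
qed

lemma two_le_L: "Q \<noteq> {} \<Longrightarrow> 2 \<le> L"
proof -
  assume "Q \<noteq> {}"
  then obtain v where "v \<in> Q"
    by blast
  then show "2 \<le> L"
    by (rule d_profile_off_path) simp
qed

text \<open>
  The sum is \<open>(L\<^sup>2 + L)/2 - a(L - a) + (L + 1)h\<close>. As \<open>h \<le> a\<close> and \<open>h \<le> L - a\<close>, the product \<open>a(L - a)\<close> is at least
  \<open>h(L - h)\<close>, which leaves \<open>h + h\<^sup>2\<close> with \<open>h \<le> L/2\<close>. Equality needs a branch of full height at the middle of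
  the path.
\<close>

lemma sum_d_P_upper:
  assumes "v \<in> Q"
  shows "(\<Sum>u\<in>P. real (d v u)) \<le> 3 * (real L)\<^sup>2 / 4 + real L"
proof -
  obtain a h where ah: "a + h \<le> L" "h \<le> a" "1 \<le> h"
    "\<And>k. k \<le> L \<Longrightarrow> real (d v (p k)) = \<bar>real k - real a\<bar> + real h"
    using d_profile_off_path[OF assms] by blast
  have "(\<Sum>u\<in>P. real (d v u)) = (\<Sum>k\<le>L. \<bar>real k - real a\<bar>) + (real L + 1) * real h"
    by (simp add: sum_P ah(4) sum.distrib)
  also have "\<dots> = ((real L)\<^sup>2 + real L) / 2 - real a * (real L - real a) + (real L + 1) * real h"
    using ah(1) by (subst sum_abs_diff_from) (auto simp: power2_eq_square field_simps)
  also have "\<dots> \<le> 3 * (real L)\<^sup>2 / 4 + real L"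
  proof -
    have r: "real h \<le> real a" "real a + real h \<le> real L"
      using ah by linarith+
    have "0 \<le> (real a - real h) * (real L - real a - real h)"
      using r by (intro mult_nonneg_nonneg) auto
    moreover have "(real h)\<^sup>2 \<le> (real L / 2)\<^sup>2"
      using r by (intro power_mono) auto
    ultimately show ?thesis
      using r by (simp add: power2_eq_square field_simps)
  qed
  finally show ?thesis .
qed

text \<open>
  The distance matrix plus the adjacency matrix. Both adjacent vertices and vertices at distance 2
  get the value 2, so the minimal distances 1 need no case distinction in the lower bound.
\<close>

abbreviation dA :: "'a \<Rightarrow> 'a \<Rightarrow> real" where
  "dA u v \<equiv> real (d u v) + of_bool (v \<in> N u)"

lemma two_le_dA:
  assumes "u \<in> V" "v \<in> V" "u \<noteq> v"
  shows "2 \<le> dA u v"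
proof -
  have "d u v \<noteq> 0"
    using assms by (simp add: d_eq_0_iff)
  moreover have "v \<in> N u" if "d u v = 1"
  proof -
    obtain w where w: "w \<in> N u" "d u v = Suc (d w v)"
      using ex_closer_neighbour[OF assms] .
    then have "w = v"
      using that assms N_verts d_eq_0_iff by auto
    then show ?thesis using w by simp
  qed
  ultimately show ?thesis
    by (cases "d u v = 1") auto
qed

text \<open>
  Every term is at least \<open>\<bar>k - a\<bar> + 1\<close> because \<open>h \<ge> 1\<close>, and the term at \<open>k = a\<close> is at least 2 because of the
  adjacency part. The rest is smallest for a branch at the middle of the path.
\<close>

lemma sum_dA_P_lower:
  assumes "v \<in> Q"
  shows "(real L)\<^sup>2 / 4 + 3 * real L / 2 + 2 \<le> (\<Sum>u\<in>P. dA v u)"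
proof -
  obtain a h where ah: "a + h \<le> L" "h \<le> a" "1 \<le> h"
    "\<And>k. k \<le> L \<Longrightarrow> real (d v (p k)) = \<bar>real k - real a\<bar> + real h"
    using d_profile_off_path[OF assms] by blast
  have a: "a \<le> L"
    using ah by simp
  have "(real L)\<^sup>2 / 4 + 3 * real L / 2 + 2 \<le> ((real a)\<^sup>2 + (real L - real a)\<^sup>2 + real L) / 2 + (real L + 2)"
    using zero_le_power2[of "real L - 2 * real a"] by (simp add: power2_eq_square field_simps)
  also have "\<dots> = (\<Sum>k\<le>L. \<bar>real k - real a\<bar> + 1 + of_bool (k = a))"
    using a by (simp add: sum.distrib sum_abs_diff_from of_bool_def)
  also have "\<dots> \<le> (\<Sum>k\<le>L. dA v (p k))"
  proof (rule sum_mono)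
    fix k assume k: "k \<in> {..L}"
    show "\<bar>real k - real a\<bar> + 1 + of_bool (k = a) \<le> dA v (p k)"
    proof (cases "k = a")
      case True
      have "v \<in> V" "v \<noteq> p a"
        using assms a by (auto simp: Q_def P_def)
      then show ?thesis
        using two_le_dA[of v "p a"] p_V[OF a] True by simp
    next
      case False
      then show ?thesis
        using ah(3) ah(4)[of k] k by simp
    qed
  qed
  finally show ?thesis
    by (simp add: sum_P)
qed

lemma card_V: "card V = card Q + L + 1"
proof -
  have "card P = L + 1"
    unfolding P_def using inj by (simp add: card_image)
  moreover have "card V = card P + card Q"
    unfolding Q_def using P_V by (metis Diff_disjoint Un_Diff_cancel card_Un_disjoint finite_Diff finite_subset le_iff_sup pair_finite_verts)
  ultimately show ?thesis by simp
qed

lemma finite_Q: "finite Q"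
  by (simp add: Q_def)

lemma total_dist_upper:
  "total_dist \<le> real L * (real L + 1) * (real L + 2) / 3
     + 2 * real (card Q) * (3 * (real L)\<^sup>2 / 4 + real L) + real (card Q) * (real (card Q) - 1) * real L"
proof -
  have "(\<Sum>u\<in>P. \<Sum>v\<in>P. real (d u v)) = real L * (real L + 1) * (real L + 2) / 3"
    unfolding sum_P sum_sum_abs_diff[symmetric] by (simp add: d_p abs_minus_commute)
  moreover have "(\<Sum>v\<in>Q. \<Sum>u\<in>P. real (d v u)) \<le> (\<Sum>v\<in>Q. 3 * (real L)\<^sup>2 / 4 + real L)"
    by (intro sum_mono sum_d_P_upper)
  moreover have "(\<Sum>u\<in>Q. \<Sum>v\<in>Q. real (d u v)) \<le> (\<Sum>u\<in>Q. \<Sum>v\<in>Q. if u = v then 0 else real L)"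
    by (intro sum_mono) (auto simp: Q_def d_self L_max)
  ultimately show ?thesis
    unfolding sum_sum_distinct[OF finite_Q] using sum_sum_split_symmetric[OF finite_verts P_V, of "\<lambda>u v. real (d u v)"]
    by (simp add: Q_def[symmetric] d_commute)
qed

lemma total_dist_lower:
  "real L * (real L + 1) * (real L + 2) / 3 + 2 * real L
     + 2 * real (card Q) * ((real L)\<^sup>2 / 4 + 3 * real L / 2 + 2) + 2 * real (card Q) * (real (card Q) - 1)
   \<le> total_dist + 2 * (real (card V) - 1)"
proof -
  have "real L * (real L + 1) * (real L + 2) / 3 + 2 * real L
      = (\<Sum>j\<le>L. \<Sum>k\<le>L. \<bar>real k - real j\<bar> + (of_bool (k = Suc j) + of_bool (j = Suc k)))"
    unfolding sum.distrib sum_sum_abs_diff[symmetric]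
    unfolding sum_sum_consecutive[symmetric] sum.distrib by simp
  also have "\<dots> \<le> (\<Sum>u\<in>P. \<Sum>v\<in>P. dA u v)"
    unfolding sum_P
  proof (intro sum_mono)
    fix j k assume "j \<in> {..L}" "k \<in> {..L}"
    then show "\<bar>real k - real j\<bar> + (of_bool (k = Suc j) + of_bool (j = Suc k)) \<le> dA (p j) (p k)"
      using step[of j] step[of k] N_sym[of "p j" "p k"] by (auto simp: d_p of_bool_def)
  qed
  finally have PP: "real L * (real L + 1) * (real L + 2) / 3 + 2 * real L \<le> (\<Sum>u\<in>P. \<Sum>v\<in>P. dA u v)" .
  have PQ: "(\<Sum>v\<in>Q. (real L)\<^sup>2 / 4 + 3 * real L / 2 + 2) \<le> (\<Sum>v\<in>Q. \<Sum>u\<in>P. dA v u)"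
    by (intro sum_mono sum_dA_P_lower)
  have QQ: "(\<Sum>u\<in>Q. \<Sum>v\<in>Q. if u = v then 0 else 2) \<le> (\<Sum>u\<in>Q. \<Sum>v\<in>Q. dA u v)"
    by (intro sum_mono) (use two_le_dA in \<open>auto simp: Q_def\<close>)
  have "(\<Sum>u\<in>V. \<Sum>v\<in>V. of_bool (v \<in> N u) :: real) = (\<Sum>u\<in>V. deg u)"
  proof (intro sum.cong refl)
    fix u
    show "(\<Sum>v\<in>V. of_bool (v \<in> N u) :: real) = deg u"
      using N_subset[of u] by (simp add: of_bool_def sum.inter_restrict[symmetric] Int_absorb1)
  qed
  then have "(\<Sum>u\<in>V. \<Sum>v\<in>V. dA u v) = total_dist + 2 * (real (card V) - 1)"
    by (simp add: sum.distrib sum_deg)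
  moreover have "dA u v = dA v u" if "u \<in> V" "v \<in> V" for u v
    using d_commute[OF that] N_sym[of u v] by simp
  ultimately show ?thesis
    using sum_sum_split_symmetric[OF finite_verts P_V, of dA] PP PQ QQ
    unfolding sum_sum_distinct[OF finite_Q] by (simp add: Q_def[symmetric])
qed

end

context undirected_tree
begin

text \<open>
  From one end of a diametral pair, step repeatedly to a neighbour nearer to the other end. The distance to that end
  determines the position on the path, whence injectivity.
\<close>

lemma ex_diametral_path:
  obtains p L where "diametral_path G p L" "real_of_ereal (graph_diameter G) = real L"
proof -
  obtain x y where xy: "x \<in> V" "y \<in> V" "real_of_ereal (graph_diameter G) = real (d x y)"
    and max: "\<And>u v. u \<in> V \<Longrightarrow> v \<in> V \<Longrightarrow> d u v \<le> d x y"
    using obtain_diametral_pair by blast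
  have "\<exists>p. p 0 = x \<and> (\<forall>k<d x y. p (Suc k) \<in> N (p k)) \<and> (\<forall>k\<le>d x y. p k \<in> V \<and> d (p k) y = d x y - k)"
    if "x \<in> V" for x
    using that
  proof (induction "d x y" arbitrary: x)
    case 0
    then show ?case by (intro exI[of _ "\<lambda>_. x"]) auto
  next
    case (Suc l)
    then have "x \<noteq> y"
      using d_self by auto
    then obtain w where w: "w \<in> N x" "d x y = Suc (d w y)"
      using ex_closer_neighbour Suc.prems xy(2) by blast
    then obtain q where q: "q 0 = w" "\<forall>k<d w y. q (Suc k) \<in> N (q k)"
      "\<forall>k\<le>d w y. q k \<in> V \<and> d (q k) y = d w y - k"
      using Suc.hyps N_verts by (metis nat.inject)
    have "case_nat x q (Suc k) \<in> N (case_nat x q k)" if "k < d x y" for k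
      using q(1,2) w that by (cases k) auto
    moreover have "case_nat x q k \<in> V \<and> d (case_nat x q k) y = d x y - k" if "k \<le> d x y" for k
      using q(3) w(2) Suc.prems that by (cases k) auto
    ultimately show ?case
      by (intro exI[of _ "case_nat x q"]) simp
  qed
  then obtain p where p: "\<forall>k<d x y. p (Suc k) \<in> N (p k)"
    "\<forall>k\<le>d x y. p k \<in> V \<and> d (p k) y = d x y - k"
    using xy(1) by blast
  have "diametral_path G p (d x y)"
  proof
    show "inj_on p {..d x y}"
    proof (rule inj_onI)
      fix j k assume "j \<in> {..d x y}" "k \<in> {..d x y}" "p j = p k"
      then have "j \<le> d x y" "k \<le> d x y" "d x y - j = d x y - k"
        using p(2) by (auto, metis)
      then show "j = k"
        by linarith
    qed
  qed (use p max in auto)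
  then show ?thesis
    by (rule that) (rule xy(3))
qed

end

section \<open>Kemeny's constant of a tree\<close>

locale nontrivial_tree = undirected_tree + nontrivial_connected_pair_graph
begin

lemma d_triangle: "u \<in> V \<Longrightarrow> v \<in> V \<Longrightarrow> w \<in> V \<Longrightarrow> d u w \<le> d u v + d v w"
proof -
  assume V: "u \<in> V" "v \<in> V" "w \<in> V"
  obtain p where p: "awalk u p v" "length p = d u v"
    using shortest_awalk[OF V(1,2)] .
  obtain q where q: "awalk v q w" "length q = d v w"
    using shortest_awalk[OF V(2,3)] .
  show "d u w \<le> d u v + d v w"
    using d_le_length[OF awalk_appendI[OF p(1) q(1)]] p(2) q(2) by simp
qed

text \<open>
  The mean hitting time for \<open>i \<noteq> j\<close>, and 0 for \<open>i = j\<close>. In a general graph the same formula holds with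
  the effective resistance in place of \<open>d\<close>.
\<close>

definition tree_hitting_time :: "'a \<Rightarrow> 'a \<Rightarrow> real" where
  "tree_hitting_time i j = (\<Sum>z\<in>V. deg z * (real (d i j) + real (d j z) - real (d i z))) / 2"

lemma tree_hitting_time_nonneg:
  assumes "i \<in> V" "j \<in> V"
  shows "0 \<le> tree_hitting_time i j"
  unfolding tree_hitting_time_def using d_triangle[OF assms]
  by (intro divide_nonneg_nonneg sum_nonneg mult_nonneg_nonneg) (auto simp: of_nat_add[symmetric] simp del: of_nat_add)

lemma tree_hitting_time_self [simp]: "j \<in> V \<Longrightarrow> tree_hitting_time j j = 0"
  by (simp add: tree_hitting_time_def d_self)

text \<open>
  The contributions \<open>deg i - 2\<close> of the two Laplacians cancel, and only their corrections at \<open>i = j\<close>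
  and \<open>z = i\<close> remain.
\<close>

lemma sum_neighbours_tree_hitting_time:
  assumes i: "i \<in> V" and j: "j \<in> V"
  shows "(\<Sum>w\<in>N i. 1 + tree_hitting_time w j)
    = deg i * tree_hitting_time i j + (if i = j then total_deg else 0)"
proof -
  have "(\<Sum>w\<in>N i. tree_hitting_time w j)
      = (\<Sum>w\<in>N i. \<Sum>z\<in>V. deg z * (real (d w j) + real (d j z) - real (d w z))) / 2"
    by (simp add: tree_hitting_time_def sum_divide_distrib)
  also have "\<dots> = (\<Sum>z\<in>V. deg z *
      ((\<Sum>w\<in>N i. real (d w j)) + deg i * real (d j z) - (\<Sum>w\<in>N i. real (d w z)))) / 2"
    by (subst sum.swap) (simp add: sum_distrib_left[symmetric] sum.distrib sum_subtractf)
  also have "\<dots> = (\<Sum>z\<in>V. deg i * (deg z * (real (d i j) + real (d j z) - real (d i z)))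
      + (if i = j then 2 * deg z else 0) - (if z = i then 2 * deg i else 0)) / 2"
    by (intro arg_cong[where f = "\<lambda>x. x / 2"] sum.cong refl)
      (auto simp: laplacian_d i j algebra_simps)
  also have "\<dots> = deg i * tree_hitting_time i j + (if i = j then total_deg else 0) - deg i"
    using i by (simp add: tree_hitting_time_def sum.distrib sum_subtractf sum_distrib_left[symmetric]
      add_divide_distrib diff_divide_distrib)
  finally show ?thesis
    by (simp add: sum.distrib)
qed

text \<open>
  At \<open>i = j\<close> the solution is the mean return time, the reciprocal of the stationary probability.
\<close>

lemma first_step_solution_tree:
  assumes j: "j \<in> V"
  shows "first_step_solution j (\<lambda>i. tree_hitting_time i j + (if i = j then total_deg / deg j else 0))"
  unfolding first_step_solution_def
proof (intro ballI conjI)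
  fix i assume i: "i \<in> V"
  show "0 \<le> tree_hitting_time i j + (if i = j then total_deg / deg j else 0)"
    using tree_hitting_time_nonneg[OF i j] total_deg_pos by simp
  have "(\<Sum>w\<in>N i. 1 + (if w = j then 0 else tree_hitting_time w j + (if w = j then total_deg / deg j else 0)))
      = (\<Sum>w\<in>N i. 1 + tree_hitting_time w j)"
    using j by (intro sum.cong) auto
  then show "deg i * (tree_hitting_time i j + (if i = j then total_deg / deg j else 0))
      = (\<Sum>w\<in>N i. 1 + (if w = j then 0 else tree_hitting_time w j + (if w = j then total_deg / deg j else 0)))"
    using N_nonempty[OF nontrivial j] by (simp add: sum_neighbours_tree_hitting_time[OF i j] distrib_left)
qed

text \<open>
  In \<open>\<Sum>j z. deg j * deg z * (d(i,j) + d(j,z) - d(i,z))\<close> the first and the last term cancel by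
  symmetry in \<open>j\<close> and \<open>z\<close>, which removes the start \<open>i\<close>. The mean return time contributes the 1 that the
  definition of Kemeny's constant subtracts.
\<close>

lemma kemeny_eq_sum_deg_deg_d:
  "kemeny G = (\<Sum>u\<in>V. \<Sum>v\<in>V. deg u * deg v * real (d u v)) / (2 * total_deg)"
proof (rule kemeny_eqI)
  fix i assume i: "i \<in> V"
  have "(\<Sum>j\<in>V. mean_hitting_time G i j * (deg j / total_deg))
      = (\<Sum>j\<in>V. tree_hitting_time i j * deg j / total_deg + (if j = i then 1 else 0))"
  proof (intro sum.cong refl)
    fix j assume j: "j \<in> V"
    show "mean_hitting_time G i j * (deg j / total_deg)
        = tree_hitting_time i j * deg j / total_deg + (if j = i then 1 else 0)"
      using mean_hitting_time_eq[OF first_step_solution_tree[OF j] i j] deg_pos[OF j] total_deg_pos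
      by (auto simp: field_simps)
  qed
  also have "\<dots> = (\<Sum>j\<in>V. tree_hitting_time i j * deg j) / total_deg + 1"
    using i by (simp add: sum.distrib sum_divide_distrib)
  finally have "(\<Sum>j\<in>V. mean_hitting_time G i j * (deg j / total_deg)) - 1
      = (\<Sum>j\<in>V. tree_hitting_time i j * deg j) / total_deg"
    by simp
  also have "(\<Sum>j\<in>V. tree_hitting_time i j * deg j)
      = (\<Sum>j\<in>V. \<Sum>z\<in>V. deg j * deg z * real (d i j) + deg j * deg z * real (d j z) - deg j * deg z * real (d i z)) / 2"
    unfolding tree_hitting_time_def sum_divide_distrib sum_distrib_right
    by (intro sum.cong refl) (simp add: field_simps)
  also have "\<dots> = (\<Sum>u\<in>V. \<Sum>v\<in>V. deg u * deg v * real (d u v)) / 2"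
  proof -
    have "(\<Sum>j\<in>V. \<Sum>z\<in>V. deg j * deg z * real (d i j)) = (\<Sum>j\<in>V. \<Sum>z\<in>V. deg j * deg z * real (d i z))"
      by (subst sum.swap) (simp add: mult.commute)
    then show ?thesis
      by (simp add: sum.distrib sum_subtractf)
  qed
  finally show "(\<Sum>j\<in>V. mean_hitting_time G i j * (deg j / total_deg)) - 1
      = (\<Sum>u\<in>V. \<Sum>v\<in>V. deg u * deg v * real (d u v)) / (2 * total_deg)"
    by simp
qed

lemma kemeny_eq_total_dist:
  "kemeny G = total_dist / (real (card V) - 1) - real (card V) + 1 / 2"
proof -
  have "real (card V) - 1 > 0"
    using total_deg_pos by (simp add: sum_deg)
  then show ?thesis
    unfolding kemeny_eq_sum_deg_deg_d sum_deg_deg_d sum_deg by (simp add: field_simps power2_eq_square)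
qed

end

theorem theorem5p3:
  fixes T :: "'a pair_pre_digraph" and n :: nat and \<delta> :: real
  assumes "is_tree T"
    and "n = card (pverts T)"
    and "\<delta> = real_of_ereal (graph_diameter T)"
  shows "real n + \<delta>\<^sup>2 / 3 - \<delta> - 1 \<le> kemeny T \<and> kemeny T \<le> real n * \<delta> - \<delta>\<^sup>2 / 2"
proof -
  interpret undirected_tree T
    using assms(1) by (simp add: undirected_tree_iff)
  obtain p L where "diametral_path T p L" and \<delta>: "\<delta> = real L"
    using ex_diametral_path assms(3) by metis
  then interpret diametral_path T p L
    by simp
  define q where "q = real (card Q)"
  have n: "real n = q + \<delta> + 1"
    using card_V by (simp add: assms(2) q_def \<delta>)
  show ?thesis
  proof (cases "n = 1")
    case True
    then have "\<delta> = 0"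
      using card_V by (simp add: assms(2) \<delta>)
    then show ?thesis
      using True assms(2) by (simp add: kemeny_def)
  next
    case False
    interpret nontrivial_tree T
      by unfold_locales (use False assms(2) in simp)
    have q: "0 \<le> q" "\<delta> \<ge> 0"
      by (simp_all add: q_def \<delta>)
    have m: "0 < q + \<delta>"
      using False q n by linarith
    \<comment> \<open>For \<open>q > 0\<close> there is a vertex off the diametral path, which forces \<open>\<delta> \<ge> 2\<close>. For \<open>\<delta> = 1\<close> the estimate of
      \<open>total_dist_lower\<close> would be too weak if \<open>q > 0\<close>.\<close>
    have cases: "q = 0 \<and> 1 \<le> \<delta> \<or> 1 \<le> q \<and> 2 \<le> \<delta>"
    proof (cases "card Q = 0")
      case True
      then show ?thesis
        using m by (simp add: q_def \<delta>)
    next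
      case False
      then have "1 \<le> card Q" "2 \<le> L"
        using two_le_L by (cases "Q = {}", simp_all)+
      then show ?thesis
        by (simp add: q_def \<delta>)
    qed
    have kemeny: "kemeny T = total_dist / (q + \<delta>) - (q + \<delta>) - 1 / 2"
      using kemeny_eq_total_dist by (simp add: assms(2)[symmetric] n)
    have lower: "(q + \<delta>) * (2 * (q + \<delta>) + \<delta>\<^sup>2 / 3 - \<delta> + 1 / 2) \<le> total_dist"
    proof -
      \<comment> \<open>The amount by which the lower bound for \<open>total_dist\<close> in \<open>total_dist_lower\<close> exceeds the one claimed here.\<close>
      have "0 \<le> \<delta> / 6 + q * (\<delta>\<^sup>2 - 3) / 6"
      proof (cases "q = 0")
        case False
        then have "2\<^sup>2 \<le> \<delta>\<^sup>2"
          using cases by (intro power_mono) auto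
        then show ?thesis
          using q by (intro add_nonneg_nonneg divide_nonneg_nonneg mult_nonneg_nonneg) auto
      qed (use q in simp)
      then show ?thesis
        using total_dist_lower unfolding assms(2)[symmetric] n q_def[symmetric] \<delta>[symmetric]
        by (simp add: field_simps power2_eq_square)
    qed
    have upper: "total_dist \<le> (q + \<delta>) * ((q + \<delta> + 1) * \<delta> - \<delta>\<^sup>2 / 2 + (q + \<delta>) + 1 / 2)"
    proof -
      have "\<delta> * 1 \<le> \<delta> * \<delta>"
        using cases by (intro mult_left_mono) auto
      moreover have "0 \<le> \<delta> * \<delta> * \<delta>" "0 \<le> q * q" "0 \<le> q * \<delta>"
        using q by simp_all
      \<comment> \<open>The amount by which the bound claimed here exceeds the one in \<open>total_dist_upper\<close>.\<close>
      ultimately have "0 \<le> q * q + q / 2 + 2 * (q * \<delta>) + \<delta> * \<delta> * \<delta> / 6 + \<delta> * \<delta> - \<delta> / 6"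
        using q by linarith
      then show ?thesis
        using total_dist_upper unfolding q_def[symmetric] \<delta>[symmetric]
        by (simp add: field_simps power2_eq_square)
    qed
    show ?thesis
      unfolding kemeny n using m lower upper by (simp add: field_simps power2_eq_square)
  qed
qed

end
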